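(* For $\theta\in(0,1)$ let $A=A_\theta:\mathbb{R}^2\to\mathbb{R}^2$ be $$A(\eta)=\begin{pmatrix}1+\sqrt{\theta}\sin(\pi\eta_1)&0\\0&1+\sqrt{\theta}\sin(\pi\eta_2)\end{pmatrix}\begin{pmatrix}\eta_1\\\eta_2\end{pmatrix},\qquad \eta=(\eta_1,\eta_2)\in\mathbb{R}^2.$$ There exist a $\theta\in(0,1)$, a $\bar p>2$ and a linear map $l:\mathbb{R}^2\to\mathbb{R}$ such that the following holds: for any $\Lambda>0$ there exist Lipschitz maps $u\in W^{1,\infty}(\mathbb{B}^2)$ and $F\in L^\infty(\mathbb{B}^2,\mathbb{R}^2)$ such that $$\begin{cases}\operatorname{div}(A(\nabla u))=\operatorname{div}F&\text{in }\mathbb{B}^2,\\ u=l&\text{on }\partial\mathbb{B}^2,\end{cases}$$ but $$\int_{\mathbb{B}^2}|\nabla u|^{\bar p}>\Lambda\left(1+\int_{\mathbb{B}^2}|F|^{\bar p}\right).$$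
   Context: $\mathbb{B}^2$ is the open unit ball of $\mathbb{R}^2$. The function $u$ is real-valued, and the equation is understood in the sense of distributions. The word "Lipschitz" refers to $u$; of $F$ only $F\in L^\infty(\mathbb{B}^2,\mathbb{R}^2)$ is required. *)

theory Defs
  imports "HOL-Analysis.Analysis"
begin

definition gradient :: "('a::euclidean_space \<Rightarrow> real) \<Rightarrow> 'a \<Rightarrow> 'a" where
  "gradient f x = (\<Sum>b\<in>Basis. frechet_derivative f (at x) b *\<^sub>R b)"

fun C_k :: "nat \<Rightarrow> ('a::euclidean_space \<Rightarrow> real) \<Rightarrow> bool" where
  "C_k 0 f \<longleftrightarrow> continuous_on UNIV f"
| "C_k (Suc k) f \<longleftrightarrow> (\<forall>x. f differentiable (at x)) \<and>
      (\<forall>b\<in>Basis. C_k k (\<lambda>x. frechet_derivative f (at x) b))"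

text \<open>Test functions on \<open>\<Omega>\<close> are represented by their extensions by zero to the whole space.\<close>

definition test_functions :: "'a::euclidean_space set \<Rightarrow> ('a \<Rightarrow> real) set" where
  "test_functions \<Omega> = {\<phi>. (\<forall>k. C_k k \<phi>) \<and>
      (\<exists>K. compact K \<and> K \<subseteq> \<Omega> \<and> (\<forall>x. x \<notin> K \<longrightarrow> \<phi> x = 0))}"

definition L_infty :: "'a::euclidean_space set \<Rightarrow> ('a \<Rightarrow> 'b::euclidean_space) set" where
  "L_infty \<Omega> = {f. f \<in> borel_measurable (lebesgue_on \<Omega>) \<and>
      (\<exists>C. AE x in lebesgue_on \<Omega>. norm (f x) \<le> C)}"

text \<open>Local integrability is required explicitly because the Bochner integral of a
  non-integrable function is \<open>0\<close>.\<close>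

definition locally_integrable :: "'a::euclidean_space set \<Rightarrow> ('a \<Rightarrow> 'b::euclidean_space) \<Rightarrow> bool" where
  "locally_integrable \<Omega> f \<longleftrightarrow> (\<forall>K. compact K \<and> K \<subseteq> \<Omega> \<longrightarrow> integrable (lebesgue_on K) f)"

definition has_weak_gradient ::
    "'a::euclidean_space set \<Rightarrow> ('a \<Rightarrow> real) \<Rightarrow> ('a \<Rightarrow> 'a) \<Rightarrow> bool" where
  "has_weak_gradient \<Omega> u G \<longleftrightarrow> locally_integrable \<Omega> u \<and> locally_integrable \<Omega> G \<and>
      (\<forall>\<phi>\<in>test_functions \<Omega>.
         (LINT x|lebesgue_on \<Omega>. u x *\<^sub>R gradient \<phi> x) = - (LINT x|lebesgue_on \<Omega>. \<phi> x *\<^sub>R G x))"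

definition W1_infty :: "'a::euclidean_space set \<Rightarrow> ('a \<Rightarrow> real) set" where
  "W1_infty \<Omega> = {u \<in> L_infty \<Omega>. \<exists>G\<in>L_infty \<Omega>. has_weak_gradient \<Omega> u G}"

definition dist_div :: "'a::euclidean_space set \<Rightarrow> ('a \<Rightarrow> 'a) \<Rightarrow> ('a \<Rightarrow> real) \<Rightarrow> real" where
  "dist_div \<Omega> V \<phi> = - (LINT x|lebesgue_on \<Omega>. V x \<bullet> gradient \<phi> x)"

definition div_eq :: "'a::euclidean_space set \<Rightarrow> ('a \<Rightarrow> 'a) \<Rightarrow> ('a \<Rightarrow> 'a) \<Rightarrow> bool" where
  "div_eq \<Omega> V W \<longleftrightarrow> locally_integrable \<Omega> V \<and> locally_integrable \<Omega> W \<and>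
      (\<forall>\<phi>\<in>test_functions \<Omega>. dist_div \<Omega> V \<phi> = dist_div \<Omega> W \<phi>)"

definition A_field :: "real \<Rightarrow> real^2 \<Rightarrow> real^2" where
  "A_field \<theta> \<eta> =
     (vector [vector [1 + sqrt \<theta> * sin (pi * \<eta> $ 1), 0],
              vector [0, 1 + sqrt \<theta> * sin (pi * \<eta> $ 2)]] :: real^2^2) *v \<eta>"

end

theory Submission imports Defs begin

text \<open>In the plane \<open>div (A (\<nabla>u)) = div F\<close> holds for \<open>F = A (\<nabla>u) - V\<close> with any divergence-free \<open>V\<close>, that is,
  with any rotated gradient. So one looks for \<open>u\<close> and a stream function \<open>w\<close> such that \<open>|\<nabla>u|^p\<close> has
  a huge integral while \<open>V\<close> is close to \<open>A (\<nabla>u)\<close> in \<open>L^p\<close>. Restricted to \<open>\<nabla>u = (x, 0)\<close>, \<open>V = (y, 0)\<close>,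
  rank-one connections are the horizontal and vertical segments of the \<open>(x, y)\<close> plane, and the
  target is the graph \<open>y = (1 + \<surd>\<theta> sin (\<pi> x)) x\<close>, which oscillates between the lines of slope
  \<open>1 - \<surd>\<theta>\<close> and \<open>1 + \<surd>\<theta>\<close>. As in the examples sharp for Meyers' estimate, a staircase laminate moves between the two lines:
  in every step the gradient grows by a fixed factor on a fixed fraction of the
  remaining mass, and everything else lands on the graph. With \<open>\<surd>\<theta> = 7/9\<close> and \<open>p = 5\<close> the growth wins.
  Finite laminates are realised by Lipschitz functions up to an arbitrarily small error, which
  amounts to the concavity of the achievable averages of \<open>|\<nabla>u|^p - \<Lambda> |F|^p\<close> along rank-one
  segments.\<close>

subsection \<open>Lipschitz functions with a gradient almost everywhere\<close>

text \<open>The gradient is carried along as an explicit field, Borel and bounded at every point, so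
  that integrands built from it are Borel and bounded without exceptional sets. Only
  differentiability is asked for almost everywhere, since the building blocks have kinks.\<close>

definition ae_grad :: "('a::euclidean_space \<Rightarrow> real) \<Rightarrow> ('a \<Rightarrow> 'a) \<Rightarrow> bool" where
  "ae_grad u G \<longleftrightarrow> (\<exists>L. L-lipschitz_on UNIV u) \<and> G \<in> borel_measurable borel \<and> bounded (range G) \<and>
     (AE x in lborel. (u has_derivative (\<lambda>v. G x \<bullet> v)) (at x))"

lemma ae_grad_measurable:
  assumes "ae_grad u G"
  shows "u \<in> borel_measurable borel" "G \<in> borel_measurable borel" "continuous_on S u"
proof -
  obtain L where "L-lipschitz_on UNIV u" using assms by (auto simp: ae_grad_def)
  then have "continuous_on UNIV u" by (rule lipschitz_on_continuous_on)
  then show "u \<in> borel_measurable borel" "continuous_on S u"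
    by (auto intro: borel_measurable_continuous_onI continuous_on_subset)
qed (use assms in \<open>simp add: ae_grad_def\<close>)

lemma ae_grad_add:
  assumes "ae_grad u G" "ae_grad v H"
  shows "ae_grad (\<lambda>x. u x + v x) (\<lambda>x. G x + H x)"
proof -
  obtain L M where "L-lipschitz_on UNIV u" "M-lipschitz_on UNIV v"
    using assms by (auto simp: ae_grad_def)
  then have "(L + M)-lipschitz_on UNIV (\<lambda>x. u x + v x)" by (rule lipschitz_on_add)
  moreover have "bounded (range (\<lambda>x. G x + H x))"
    using assms by (intro bounded_plus_comp) (auto simp: ae_grad_def)
  moreover have "AE x in lborel. (u has_derivative (\<lambda>v. G x \<bullet> v)) (at x)"
    "AE x in lborel. (v has_derivative (\<lambda>v. H x \<bullet> v)) (at x)"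
    using assms by (auto simp: ae_grad_def)
  then have "AE x in lborel. ((\<lambda>x. u x + v x) has_derivative (\<lambda>v. (G x + H x) \<bullet> v)) (at x)"
  proof eventually_elim
    case (elim x)
    from has_derivative_add[OF this] show ?case by (simp add: inner_add_left)
  qed
  ultimately show ?thesis using assms by (auto simp: ae_grad_def)
qed

lemma ae_grad_scale:
  assumes "ae_grad u G"
  shows "ae_grad (\<lambda>x. c * u x) (\<lambda>x. c *\<^sub>R G x)"
proof -
  obtain L where "L-lipschitz_on UNIV u" using assms by (auto simp: ae_grad_def)
  then have "(\<bar>c\<bar> * L)-lipschitz_on UNIV (\<lambda>x. c * u x)" by (rule lipschitz_on_cmult_real)
  moreover have "bounded (range (\<lambda>x. c *\<^sub>R G x))"
    using bounded_scaling[of "range G" c] assms by (auto simp: ae_grad_def image_image)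
  moreover have "AE x in lborel. (u has_derivative (\<lambda>v. G x \<bullet> v)) (at x)"
    using assms by (auto simp: ae_grad_def)
  then have "AE x in lborel. ((\<lambda>x. c * u x) has_derivative (\<lambda>v. (c *\<^sub>R G x) \<bullet> v)) (at x)"
  proof eventually_elim
    case (elim x)
    from has_derivative_mult_right[OF this, of c] show ?case by simp
  qed
  ultimately show ?thesis using assms by (auto simp: ae_grad_def)
qed

lemma ae_grad_linear: "ae_grad (\<lambda>x. P \<bullet> x) (\<lambda>x. P)"
proof -
  have "(norm P)-lipschitz_on UNIV (\<lambda>x. P \<bullet> x)"
    by (rule lipschitz_onI) (auto simp: dist_norm inner_diff_right[symmetric] Cauchy_Schwarz_ineq2)
  moreover have "((\<lambda>x. P \<bullet> x) has_derivative (\<lambda>v. P \<bullet> v)) (at x)" for x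
    by (auto intro!: derivative_eq_intros)
  ultimately show ?thesis by (auto simp: ae_grad_def)
qed

section \<open>Integration by parts through difference quotients\<close>

lemma integral_translation_lborel:
  fixes f :: "'a::euclidean_space \<Rightarrow> real"
  assumes "f \<in> borel_measurable borel"
  shows "(LINT x|lborel. f (x + a)) = (LINT x|lborel. f x)"
proof -
  have "(LINT x|lborel. f x) = (LINT x|distr lborel borel ((+) a). f x)"
    by (simp add: lborel_distr_plus)
  also have "\<dots> = (LINT x|lborel. f (a + x))"
    by (rule integral_distr) (use assms in auto)
  finally show ?thesis by (simp add: add.commute)
qed

text \<open>The Lipschitz constant bounds all quotients at once, so dominated convergence applies
  with a multiple of the modulus of \<open>h\<close>.\<close>

lemma ae_grad_difference_quotient:
  fixes u :: "'a::euclidean_space \<Rightarrow> real"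
  assumes u: "ae_grad u G" and h: "integrable lborel h" and t: "t \<longlonglongrightarrow> 0" "\<And>n::nat. t n \<noteq> 0"
  shows "(\<lambda>n. LINT x|lborel. (u (x + t n *\<^sub>R c) - u x) / t n * h x) \<longlonglongrightarrow> (LINT x|lborel. (G x \<bullet> c) * h x)"
proof -
  obtain L where L: "L-lipschitz_on UNIV u" using u by (auto simp: ae_grad_def)
  note [measurable] = ae_grad_measurable(1,2)[OF u] borel_measurable_integrable[OF h]
  have 1: "AE x in lborel. (u has_derivative (\<lambda>v. G x \<bullet> v)) (at x)"
    using u by (simp add: ae_grad_def)
  show ?thesis
  proof (rule integral_dominated_convergence[where w="\<lambda>x. L * norm c * \<bar>h x\<bar>"])
    show "integrable lborel (\<lambda>x. L * norm c * \<bar>h x\<bar>)" using h by simp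
    show "AE x in lborel. (\<lambda>n. (u (x + t n *\<^sub>R c) - u x) / t n * h x) \<longlonglongrightarrow> (G x \<bullet> c) * h x"
      using 1
    proof eventually_elim
      case (elim x)
      have "((\<lambda>s. u (x + s *\<^sub>R c)) has_derivative (\<lambda>s. G x \<bullet> (s *\<^sub>R c))) (at 0)"
        by (rule has_derivative_compose[of "\<lambda>s. x + s *\<^sub>R c" _ 0 UNIV u, simplified])
           (use elim in \<open>auto intro!: derivative_eq_intros\<close>)
      then have "((\<lambda>s. u (x + s *\<^sub>R c)) has_real_derivative (G x \<bullet> c)) (at 0)"
        by (simp add: has_field_derivative_def mult_commute_abs)
      then have "((\<lambda>s. (u (x + s *\<^sub>R c) - u x) / s) \<longlongrightarrow> G x \<bullet> c) (at 0)"
        by (simp add: DERIV_def)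
      moreover have "filterlim t (at 0) sequentially"
        using t by (auto simp: filterlim_at)
      ultimately have "(\<lambda>n. (u (x + t n *\<^sub>R c) - u x) / t n) \<longlonglongrightarrow> G x \<bullet> c"
        by (rule filterlim_compose)
      then show ?case by (intro tendsto_intros)
    qed
    show "AE x in lborel. norm ((u (x + t n *\<^sub>R c) - u x) / t n * h x) \<le> L * norm c * \<bar>h x\<bar>" for n
    proof (rule AE_I2)
      fix x
      have "\<bar>u (x + t n *\<^sub>R c) - u x\<bar> \<le> L * (\<bar>t n\<bar> * norm c)"
        using lipschitz_onD[OF L, of "x + t n *\<^sub>R c" x] by (simp add: dist_norm)
      then have "\<bar>(u (x + t n *\<^sub>R c) - u x) / t n\<bar> \<le> L * norm c"
        using t(2)[of n] by (simp add: divide_le_eq mult_ac)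
      from mult_right_mono[OF this, of "\<bar>h x\<bar>"]
      show "norm ((u (x + t n *\<^sub>R c) - u x) / t n * h x) \<le> L * norm c * \<bar>h x\<bar>"
        by (simp add: abs_mult)
    qed
  qed measurable
qed

lemma integrable_bounded_support:
  fixes f :: "'a::euclidean_space \<Rightarrow> 'b::euclidean_space"
  assumes "f \<in> borel_measurable borel" "\<And>x. norm x \<le> r \<Longrightarrow> norm (f x) \<le> B" "\<And>x. r < norm x \<Longrightarrow> f x = 0"
  shows "integrable lborel f"
  by (rule integrableI_bounded_set[where A="cball 0 r" and B=B])
     (use assms emeasure_lborel_cball_finite[of 0 r] in \<open>auto simp: not_le\<close>)

lemma ae_grad_bound_cball:
  assumes "ae_grad u G"
  obtains B where "\<And>x. norm x \<le> r \<Longrightarrow> \<bar>u x\<bar> \<le> B"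
proof -
  have "compact (u ` cball 0 r)"
    by (rule compact_continuous_image[OF ae_grad_measurable(3)[OF assms]]) simp
  then obtain B where "\<forall>y\<in>u ` cball 0 r. norm y \<le> B" 
    using compact_imp_bounded bounded_iff by blast
  then show ?thesis by (intro that[of B]) auto
qed

lemma ae_grad_bound:
  assumes "ae_grad u G"
  obtains B where "\<And>x. norm (G x) \<le> B"
  using assms by (auto simp: ae_grad_def bounded_iff)

text \<open>Discrete integration by parts: translation invariance moves the shift from
  \<open>u\<close> to \<open>k\<close>. As \<open>u\<close> may grow linearly, it is bounded only on
  a ball containing the support of \<open>k\<close> and of its translate.\<close>

lemma integral_shift_difference:
  fixes u k :: "'a::euclidean_space \<Rightarrow> real"
  assumes [measurable]: "u \<in> borel_measurable borel" "k \<in> borel_measurable borel"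
    and u: "\<And>x. norm x \<le> r + norm a \<Longrightarrow> \<bar>u x\<bar> \<le> B"
    and k: "\<And>x. \<bar>k x\<bar> \<le> C" "\<And>x. r < norm x \<Longrightarrow> k x = 0"
  shows "(LINT x|lborel. (u (x + a) - u x) * k x) = (LINT x|lborel. u x * (k (x - a) - k x))"
proof -
  have int: "integrable lborel (\<lambda>x. u x * k (x - b))" if "norm b \<le> norm a" for b
  proof (rule integrable_bounded_support[of _ "r + norm a" "B * C"])
    show "norm (u x * k (x - b)) \<le> B * C" if "norm x \<le> r + norm a" for x
      unfolding real_norm_def abs_mult using u[OF that] k(1)[of "x - b"] abs_ge_zero[of "u x"]
      by (intro mult_mono) linarith+
    show "u x * k (x - b) = 0" if "r + norm a < norm x" for x
      using norm_triangle_ineq2[of x b] that \<open>norm b \<le> norm a\<close> k(2)[of "x - b"] by simp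
  qed measurable
  have "integrable lborel (\<lambda>x. (\<lambda>x. u x * k (x - a)) (a + x))"
    using int[OF order_refl]
    by (subst (asm) lborel_distr_plus[symmetric, of a], subst (asm) integrable_distr_eq) auto
  then have int': "integrable lborel (\<lambda>x. u (x + a) * k x)" by (simp add: add.commute)
  have int0: "integrable lborel (\<lambda>x. u x * k x)" using int[of 0] by simp
  have "(LINT x|lborel. u (x + a) * k x) = (LINT x|lborel. (\<lambda>x. u x * k (x - a)) (x + a))" by simp
  also have "\<dots> = (LINT x|lborel. u x * k (x - a))" by (rule integral_translation_lborel) measurable
  finally show ?thesis
    using int[of a] int0 int' by (simp add: left_diff_distrib right_diff_distrib)
qed

text \<open>This is the limit of \<open>integral_shift_difference\<close> for shifts along
  \<open>c\<close> that tend to zero; both sides converge by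
  \<open>ae_grad_difference_quotient\<close>.\<close>

lemma ae_grad_integral_by_parts:
  fixes u v :: "'a::euclidean_space \<Rightarrow> real"
  assumes u: "ae_grad u G" and v: "ae_grad v K" and supp: "\<And>x. r < norm x \<Longrightarrow> v x = 0 \<and> K x = 0"
  shows "(LINT x|lborel. (G x \<bullet> c) * v x) = - (LINT x|lborel. u x * (K x \<bullet> c))"
proof -
  note [measurable] = ae_grad_measurable(1,2)[OF u] ae_grad_measurable(1,2)[OF v]
  define t where "t = (\<lambda>n. inverse (real (Suc n)))"
  have t: "t \<longlonglongrightarrow> 0" "(\<lambda>n. - t n) \<longlonglongrightarrow> 0"
    using LIMSEQ_inverse_real_of_nat tendsto_minus[OF LIMSEQ_inverse_real_of_nat]
    unfolding t_def by simp_all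
  have t0: "t n \<noteq> 0" "- t n \<noteq> 0" and t1: "\<bar>t n\<bar> \<le> 1" for n
    by (auto simp: t_def divide_simps)
  \<comment> \<open>As \<open>t n\<close> is at most 1 in modulus, the ball of radius
    \<open>R\<close> contains the support of \<open>v\<close> and of all translates that
    occur.\<close>
  define R where "R = r + norm c"
  have "r \<le> R" by (simp add: R_def)
  then have suppR: "v x = 0 \<and> K x = 0" if "R < norm x" for x using that by (intro supp) linarith
  \<comment> \<open>The function \<open>u\<close> need not be integrable. Cutting it off at radius
    \<open>R\<close> makes it an admissible weight and changes no product with an increment of
    \<open>v\<close>.\<close>
  define h where "h x = indicator (cball 0 R) x * u x" for x
  obtain B where B: "\<And>x. norm x \<le> R \<Longrightarrow> \<bar>u x\<bar> \<le> B" using ae_grad_bound_cball[OF u, of R] by blast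
  obtain C where C: "\<And>x. norm x \<le> r \<Longrightarrow> \<bar>v x\<bar> \<le> C" using ae_grad_bound_cball[OF v, of r] by blast
  have vb: "\<bar>v x\<bar> \<le> max 0 C" for x using C[of x] supp[of x] by (cases "norm x \<le> r") auto
  have ih: "integrable lborel h"
    by (rule integrable_bounded_support[of _ R B]) (use B in \<open>auto simp: h_def[abs_def] intro!: borel_measurable_times borel_measurable_indicator\<close>)
  have iv: "integrable lborel v"
    by (rule integrable_bounded_support[of _ r C]) (use C supp in auto)
  have eq: "(LINT x|lborel. (u (x + t n *\<^sub>R c) - u x) / t n * v x) =
      - (LINT x|lborel. (v (x + (- t n) *\<^sub>R c) - v x) / (- t n) * h x)" for n
  proof -
    let ?a = "t n *\<^sub>R c"
    have na: "norm ?a \<le> norm c" using t1[of n] by (simp add: mult_left_le_one_le)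
    have h: "u x * (v (x - ?a) - v x) = (v (x - ?a) - v x) * h x" for x
    proof (cases "norm x \<le> R")
      case False
      then have "r < norm (x - ?a)" "r < norm x"
        using norm_triangle_ineq2[of x ?a] na norm_ge_zero[of c] False unfolding R_def by linarith+
      then show ?thesis using supp by simp
    qed (simp add: h_def)
    have "(LINT x|lborel. (u (x + ?a) - u x) / t n * v x) = (LINT x|lborel. (u (x + ?a) - u x) * v x) / t n"
      by (simp flip: integral_divide_zero)
    also have "(LINT x|lborel. (u (x + ?a) - u x) * v x) = (LINT x|lborel. u x * (v (x - ?a) - v x))"
      by (rule integral_shift_difference[where r=r and B=B and C="max 0 C"])
         (use B vb supp na in \<open>auto simp: R_def\<close>)
    also have "\<dots> / t n = - (LINT x|lborel. (v (x + (- t n) *\<^sub>R c) - v x) / (- t n) * h x)"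
      unfolding h by (simp flip: integral_divide_zero integral_minus)
    finally show ?thesis .
  qed
  have "(\<lambda>n. LINT x|lborel. (u (x + t n *\<^sub>R c) - u x) / t n * v x) \<longlonglongrightarrow> (LINT x|lborel. (G x \<bullet> c) * v x)"
    by (rule ae_grad_difference_quotient[OF u iv t(1) t0(1)])
  moreover have "(\<lambda>n. - (LINT x|lborel. (v (x + (- t n) *\<^sub>R c) - v x) / (- t n) * h x)) \<longlonglongrightarrow> - (LINT x|lborel. (K x \<bullet> c) * h x)"
    by (intro tendsto_minus ae_grad_difference_quotient[OF v ih t(2) t0(2)])
  ultimately have "(LINT x|lborel. (G x \<bullet> c) * v x) = - (LINT x|lborel. (K x \<bullet> c) * h x)"
    unfolding eq by (rule LIMSEQ_unique)
  also have "(\<lambda>x. (K x \<bullet> c) * h x) = (\<lambda>x. u x * (K x \<bullet> c))"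
  proof
    fix x show "(K x \<bullet> c) * h x = u x * (K x \<bullet> c)"
      using suppR[of x] by (cases "norm x \<le> R") (auto simp: h_def)
  qed
  finally show ?thesis .
qed

text \<open>The derivative of \<open>v\<close> exists everywhere, hence at both \<open>x\<close> and
  \<open>x + a\<close>. The increment can then replace \<open>v\<close> in
  \<open>ae_grad_integral_by_parts\<close>.\<close>

lemma ae_grad_difference:
  fixes v :: "'a::euclidean_space \<Rightarrow> real"
  assumes v: "ae_grad v K" and D: "\<And>x. (v has_derivative (\<lambda>y. K x \<bullet> y)) (at x)"
  shows "ae_grad (\<lambda>x. v (x + a) - v x) (\<lambda>x. K (x + a) - K x)"
proof -
  note [measurable] = ae_grad_measurable(1,2)[OF v]
  obtain L where L: "L-lipschitz_on UNIV v" using v by (auto simp: ae_grad_def)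
  have "L-lipschitz_on UNIV (\<lambda>x. v (x + a))"
    using L by (auto simp: lipschitz_on_def dist_norm) (metis add_diff_cancel_right)
  then have lip: "(L + L)-lipschitz_on UNIV (\<lambda>x. v (x + a) - v x)" using L by (rule lipschitz_on_diff)
  obtain B where B: "\<And>x. norm (K x) \<le> B" using ae_grad_bound[OF v] by blast
  have "norm (K (x + a) - K x) \<le> B + B" for x
    using norm_triangle_ineq4[of "K (x + a)" "K x"] B[of x] B[of "x + a"] by linarith
  then have "bounded (range (\<lambda>x. K (x + a) - K x))" by (auto simp: bounded_iff)
  moreover have "((\<lambda>x. v (x + a)) has_derivative (\<lambda>y. K (x + a) \<bullet> y)) (at x)" for x
    by (rule has_derivative_compose[of "\<lambda>x. x + a" "\<lambda>y. y" x UNIV v "\<lambda>y. K (x + a) \<bullet> y", simplified])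
       (use D in \<open>auto intro!: derivative_eq_intros\<close>)
  from has_derivative_diff[OF this D]
  have "((\<lambda>x. v (x + a) - v x) has_derivative (\<lambda>y. (K (x + a) - K x) \<bullet> y)) (at x)" for x
    by (simp add: inner_diff_left)
  ultimately show ?thesis using lip by (auto simp: ae_grad_def)
qed

text \<open>In the plane this says that a rotated gradient is divergence free. Difference quotients
  are moved across the integral so that no second derivatives of \<open>v\<close> are needed.\<close>

lemma ae_grad_integral_swap:
  fixes u v :: "'a::euclidean_space \<Rightarrow> real"
  assumes u: "ae_grad u G" and v: "ae_grad v K" and D: "\<And>x. (v has_derivative (\<lambda>y. K x \<bullet> y)) (at x)"
    and supp: "\<And>x. r < norm x \<Longrightarrow> v x = 0 \<and> K x = 0"
  shows "(LINT x|lborel. (G x \<bullet> b) * (K x \<bullet> c)) = (LINT x|lborel. (G x \<bullet> c) * (K x \<bullet> b))"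
proof -
  note [measurable] = ae_grad_measurable(1,2)[OF u] ae_grad_measurable(1,2)[OF v]
  define t where "t = (\<lambda>n. inverse (real (Suc n)))"
  have t: "t \<longlonglongrightarrow> 0" "(\<lambda>n. - t n) \<longlonglongrightarrow> 0"
    using LIMSEQ_inverse_real_of_nat tendsto_minus[OF LIMSEQ_inverse_real_of_nat]
    unfolding t_def by simp_all
  have t0: "t n \<noteq> 0" "- t n \<noteq> 0" and t1: "\<bar>t n\<bar> \<le> 1" for n
    by (auto simp: t_def divide_simps)
  define R where "R = r + norm c"
  have "r \<le> R" by (simp add: R_def)
  then have suppR: "v x = 0 \<and> K x = 0" if "R < norm x" for x using that by (intro supp) linarith
  define h where "h x = indicator (cball 0 R) x * (G x \<bullet> b)" for x
  define k where "k x = K x \<bullet> b" for x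
  have [measurable]: "h \<in> borel_measurable borel" "k \<in> borel_measurable borel"
    by (auto simp: h_def[abs_def] k_def[abs_def] intro!: borel_measurable_times borel_measurable_indicator)
  obtain BG where BG: "\<And>x. norm (G x) \<le> BG" using ae_grad_bound[OF u] by blast
  obtain BK where BK: "\<And>x. norm (K x) \<le> BK" using ae_grad_bound[OF v] by blast
  have hb: "\<bar>G x \<bullet> b\<bar> \<le> BG * norm b" for x
    using Cauchy_Schwarz_ineq2[of "G x" b] mult_right_mono[OF BG[of x], of "norm b"] by simp
  have kb: "\<bar>k x\<bar> \<le> BK * norm b" for x
    unfolding k_def using Cauchy_Schwarz_ineq2[of "K x" b] mult_right_mono[OF BK[of x], of "norm b"] by simp
  obtain B where B: "\<And>x. norm x \<le> R \<Longrightarrow> \<bar>u x\<bar> \<le> B" using ae_grad_bound_cball[OF u, of R] by blast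
  have ih: "integrable lborel h"
    by (rule integrable_bounded_support[of _ R "BG * norm b"]) (use hb in \<open>auto simp: h_def\<close>)
  have ik: "integrable lborel k"
    by (rule integrable_bounded_support[of _ r "BK * norm b"]) (use kb supp in \<open>auto simp: k_def\<close>)
  \<comment> \<open>Integration by parts moves the derivative in direction \<open>b\<close> from
    \<open>u\<close> to the increment of \<open>v\<close>; the shift along \<open>c\<close> is then
    moved from \<open>v\<close> to \<open>u\<close>. In the limit the two directions have changed
    places.\<close>
  have eq: "(LINT x|lborel. (v (x + t n *\<^sub>R c) - v x) / t n * h x) =
      (LINT x|lborel. (u (x + (- t n) *\<^sub>R c) - u x) / (- t n) * k x)" for n
  proof -
    let ?a = "t n *\<^sub>R c"
    have na: "norm ?a \<le> norm c" using t1[of n] by (simp add: mult_left_le_one_le)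
    have supp': "v (x + ?a) - v x = 0 \<and> K (x + ?a) - K x = 0" if "R < norm x" for x
    proof -
      have "r < norm (x + ?a)" "r < norm x"
        using norm_triangle_ineq2[of x "- ?a"] na norm_ge_zero[of c] that
        unfolding R_def norm_minus_cancel diff_minus_eq_add by linarith+
      then show ?thesis using supp by simp
    qed
    have h: "(v (x + ?a) - v x) / t n * h x = (G x \<bullet> b) * (v (x + ?a) - v x) / t n" for x
      using supp'[of x] by (cases "norm x \<le> R") (auto simp: h_def)
    have "(LINT x|lborel. (v (x + t n *\<^sub>R c) - v x) / t n * h x) =
        (LINT x|lborel. (G x \<bullet> b) * (v (x + ?a) - v x)) / t n"
      unfolding h by simp
    also have "(LINT x|lborel. (G x \<bullet> b) * (v (x + ?a) - v x)) =
        - (LINT x|lborel. u x * ((K (x + ?a) - K x) \<bullet> b))"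
      by (rule ae_grad_integral_by_parts[OF u ae_grad_difference[OF v D]]) (use supp' in auto)
    also have "(LINT x|lborel. u x * ((K (x + ?a) - K x) \<bullet> b)) = (LINT x|lborel. u x * (k (x - (- ?a)) - k x))"
      by (simp add: k_def inner_diff_left)
    also have "\<dots> = (LINT x|lborel. (u (x + (- ?a)) - u x) * k x)"
      by (rule integral_shift_difference[symmetric, where r=r and B=B and C="BK * norm b"])
         (use B kb supp na in \<open>auto simp: R_def k_def\<close>)
    also have "- \<dots> / t n = (LINT x|lborel. (u (x + (- t n) *\<^sub>R c) - u x) / (- t n) * k x)"
      by (simp flip: integral_divide_zero integral_minus)
    finally show ?thesis .
  qed
  have "(\<lambda>n. LINT x|lborel. (v (x + t n *\<^sub>R c) - v x) / t n * h x) \<longlonglongrightarrow> (LINT x|lborel. (K x \<bullet> c) * h x)"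
    by (rule ae_grad_difference_quotient[OF v ih t(1) t0(1)])
  moreover have "(\<lambda>n. LINT x|lborel. (u (x + (- t n) *\<^sub>R c) - u x) / (- t n) * k x) \<longlonglongrightarrow> (LINT x|lborel. (G x \<bullet> c) * k x)"
    by (rule ae_grad_difference_quotient[OF u ik t(2) t0(2)])
  ultimately have "(LINT x|lborel. (K x \<bullet> c) * h x) = (LINT x|lborel. (G x \<bullet> c) * k x)"
    unfolding eq by (rule LIMSEQ_unique)
  moreover have "(K x \<bullet> c) * h x = (G x \<bullet> b) * (K x \<bullet> c)" for x
    using suppR[of x] by (cases "norm x \<le> R") (auto simp: h_def)
  ultimately show ?thesis by (simp add: k_def)
qed

subsection \<open>Piecewise linear profiles\<close>

text \<open>At the finitely many kinks in \<open>Z\<close> the value of \<open>f'\<close> is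
  arbitrary. The bound on \<open>f\<close> makes products of profiles in different coordinates
  Lipschitz.\<close>

definition pw_deriv :: "(real \<Rightarrow> real) \<Rightarrow> (real \<Rightarrow> real) \<Rightarrow> bool" where
  "pw_deriv f f' \<longleftrightarrow> (\<exists>L. L-lipschitz_on UNIV f) \<and> bounded (range f) \<and>
     f' \<in> borel_measurable borel \<and> bounded (range f') \<and>
     (\<exists>Z. finite Z \<and> (\<forall>t. t \<notin> Z \<longrightarrow> (f has_real_derivative f' t) (at t)))"

text \<open>A trapezoid: it rises from \<open>s\<close> to height \<open>M\<close> at
  \<open>p\<close>, stays there until \<open>q\<close>, falls until \<open>s'\<close> and is zero
  elsewhere. For \<open>p = q\<close> it is a triangular tooth, and for \<open>M = 1\<close> a
  cut-off.\<close>

definition trap :: "real \<Rightarrow> real \<Rightarrow> real \<Rightarrow> real \<Rightarrow> real \<Rightarrow> real \<Rightarrow> real" where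
  "trap M s p q s' t = max 0 (min M (min (M / (p - s) * (t - s)) (M / (s' - q) * (s' - t))))"

definition trap' :: "real \<Rightarrow> real \<Rightarrow> real \<Rightarrow> real \<Rightarrow> real \<Rightarrow> real \<Rightarrow> real" where
  "trap' M s p q s' t = (if s < t \<and> t < p then M / (p - s) else if q < t \<and> t < s' then - (M / (s' - q)) else 0)"

context
  fixes M s p q s' :: real
  assumes ord: "s < p" "p \<le> q" "q < s'" and M: "0 < M"
begin

lemma trap_left: "t \<le> s \<Longrightarrow> trap M s p q s' t = 0"
proof -
  assume "t \<le> s"
  then have "M / (p - s) * (t - s) \<le> 0" using ord M by (intro mult_nonneg_nonpos) auto
  then show ?thesis unfolding trap_def by linarith
qed

lemma trap_right: "s' \<le> t \<Longrightarrow> trap M s p q s' t = 0"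
proof -
  assume "s' \<le> t"
  then have "M / (s' - q) * (s' - t) \<le> 0" using ord M by (intro mult_nonneg_nonpos) auto
  then show ?thesis unfolding trap_def by linarith
qed

lemma trap_up: "s \<le> t \<Longrightarrow> t \<le> p \<Longrightarrow> trap M s p q s' t = M / (p - s) * (t - s)"
proof -
  assume t: "s \<le> t" "t \<le> p"
  have "M / (p - s) * (t - s) \<le> M" "M \<le> M / (s' - q) * (s' - t)" "0 \<le> M / (p - s) * (t - s)"
    using ord M t by (auto simp: field_simps)
  then show ?thesis by (simp add: trap_def)
qed

lemma trap_down: "q \<le> t \<Longrightarrow> t \<le> s' \<Longrightarrow> trap M s p q s' t = M / (s' - q) * (s' - t)"
proof -
  assume t: "q \<le> t" "t \<le> s'"
  have "M / (s' - q) * (s' - t) \<le> M" "M \<le> M / (p - s) * (t - s)" "0 \<le> M / (s' - q) * (s' - t)"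
    using ord M t by (auto simp: field_simps)
  then show ?thesis by (simp add: trap_def)
qed

lemma trap_mid: "p \<le> t \<Longrightarrow> t \<le> q \<Longrightarrow> trap M s p q s' t = M"
proof -
  assume t: "p \<le> t" "t \<le> q"
  have "M \<le> M / (s' - q) * (s' - t)" "M \<le> M / (p - s) * (t - s)"
    using ord M t by (auto simp: field_simps)
  then show ?thesis using M by (simp add: trap_def)
qed

lemma trap_range: "0 \<le> trap M s p q s' t" "trap M s p q s' t \<le> M"
  using M by (auto simp: trap_def)

lemma trap_has_derivative:
  assumes "t \<notin> {s, p, q, s'}"
  shows "(trap M s p q s' has_real_derivative trap' M s p q s' t) (at t)"
proof -
  have *: "(trap M s p q s' has_real_derivative D) (at t)"
    if "(g has_real_derivative D) (at t)" "open U" "t \<in> U" "\<And>x. x \<in> U \<Longrightarrow> g x = trap M s p q s' x" for g D U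
    using has_field_derivative_transform_within_open[OF that(1-3)] that(4) by blast
  have ne: "t \<noteq> s" "t \<noteq> p" "t \<noteq> q" "t \<noteq> s'" using assms by auto
  have lin: "((\<lambda>t. c * (t - z)) has_real_derivative c) (at t)" "((\<lambda>t. c * (z - t)) has_real_derivative - c) (at t)"
    for c z :: real
    by (auto intro!: derivative_eq_intros)
  consider "t < s" | "s < t" "t < p" | "p < t" "t < q" | "q < t" "t < s'" | "s' < t"
    using ne by linarith
  then show ?thesis
  proof cases
    case 1
    then have D: "trap' M s p q s' t = 0" using ord by (simp add: trap'_def)
    show ?thesis unfolding D
      by (rule *[OF DERIV_const, of "{..<s}"]) (use 1 in \<open>simp_all add: trap_left\<close>)
  next
    case 2
    then have D: "trap' M s p q s' t = M / (p - s)" by (simp add: trap'_def)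
    show ?thesis unfolding D
      by (rule *[OF lin(1)[of _ s], of "{s<..<p}"]) (use 2 in \<open>simp_all add: trap_up\<close>)
  next
    case 3
    then have D: "trap' M s p q s' t = 0" by (simp add: trap'_def)
    show ?thesis unfolding D
      by (rule *[OF DERIV_const, of "{p<..<q}"]) (use 3 in \<open>simp_all add: trap_mid\<close>)
  next
    case 4
    then have D: "trap' M s p q s' t = - (M / (s' - q))" using ord by (simp add: trap'_def)
    show ?thesis unfolding D
      by (rule *[OF lin(2)[of _ s'], of "{q<..<s'}"]) (use 4 in \<open>simp_all add: trap_down\<close>)
  next
    case 5
    then have D: "trap' M s p q s' t = 0" using ord by (simp add: trap'_def)
    show ?thesis unfolding D
      by (rule *[OF DERIV_const, of "{s'<..}"]) (use 5 in \<open>simp_all add: trap_right\<close>)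
  qed
qed

lemma trap_lipschitz: "(M / (p - s) + M / (s' - q))-lipschitz_on UNIV (trap M s p q s')"
proof (rule lipschitz_onI)
  fix x y :: real
  define a b where "a = M / (p - s)" and "b = M / (s' - q)"
  have nn: "0 \<le> a" "0 \<le> b" using ord M by (auto simp: a_def b_def)
  have max0: "\<bar>max 0 x - max 0 y\<bar> \<le> \<bar>x - y\<bar>" for x y :: real by linarith
  have minM: "\<bar>min z x - min z y\<bar> \<le> \<bar>x - y\<bar>" for x y z :: real by linarith
  have min2: "\<bar>min x x' - min y y'\<bar> \<le> \<bar>x - y\<bar> + \<bar>x' - y'\<bar>" for x y x' y' :: real by linarith
  define X X' Y Y' where "X = a * (x - s)" "X' = b * (s' - x)" "Y = a * (y - s)" "Y' = b * (s' - y)"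
  have "X - Y = a * (x - y)" "X' - Y' = b * (y - x)"
    by (auto simp: X_X'_Y_Y'_def algebra_simps)
  then have "\<bar>X - Y\<bar> = a * \<bar>x - y\<bar>" "\<bar>X' - Y'\<bar> = b * \<bar>x - y\<bar>"
    using nn by (auto simp: abs_mult)
  moreover have "0 \<le> a * \<bar>x - y\<bar>" "0 \<le> b * \<bar>x - y\<bar>" using nn by auto
  moreover have "\<bar>max 0 (min M (min X X')) - max 0 (min M (min Y Y'))\<bar> \<le> \<bar>X - Y\<bar> + \<bar>X' - Y'\<bar>"
    using max0[of "min M (min X X')" "min M (min Y Y')"] minM[of M "min X X'" "min Y Y'"] min2[of X X' Y Y']
    by linarith
  ultimately show "dist (trap M s p q s' x) (trap M s p q s' y) \<le> (M / (p - s) + M / (s' - q)) * dist x y"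
    unfolding trap_def dist_real_def distrib_right a_def[symmetric] b_def[symmetric] X_X'_Y_Y'_def[symmetric]
    by linarith
qed (use ord M in auto)

lemma pw_deriv_trap: "pw_deriv (trap M s p q s') (trap' M s p q s')"
  unfolding pw_deriv_def
proof (intro conjI exI)
  show "(M / (p - s) + M / (s' - q))-lipschitz_on UNIV (trap M s p q s')" by (rule trap_lipschitz)
  show "bounded (range (trap M s p q s'))"
    by (rule bounded_subset[of "{0..M}"]) (use trap_range in auto)
  show "trap' M s p q s' \<in> borel_measurable borel" unfolding trap'_def[abs_def] by measurable
  show "bounded (range (trap' M s p q s'))"
    by (rule finite_imp_bounded, rule finite_subset[of _ "{M / (p - s), - (M / (s' - q)), 0}"])
       (auto simp: trap'_def)
  show "finite {s, p, q, s'}" by simp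
  show "\<forall>t. t \<notin> {s, p, q, s'} \<longrightarrow> (trap M s p q s' has_real_derivative trap' M s p q s' t) (at t)"
    using trap_has_derivative by blast
qed

end

lemma pw_derivE:
  assumes "pw_deriv f f'"
  obtains L B B' Z where "L-lipschitz_on UNIV f" "\<And>t. \<bar>f t\<bar> \<le> B" "\<And>t. \<bar>f' t\<bar> \<le> B'"
    "finite Z" "\<And>t. t \<notin> Z \<Longrightarrow> (f has_real_derivative f' t) (at t)"
proof -
  obtain L B B' Z where *: "L-lipschitz_on UNIV f" "\<forall>y\<in>range f. norm y \<le> B" "\<forall>y\<in>range f'. norm y \<le> B'"
    "finite Z" "\<forall>t. t \<notin> Z \<longrightarrow> (f has_real_derivative f' t) (at t)"
    using assms unfolding pw_deriv_def bounded_iff by blast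
  show thesis by (rule that[of L B B' Z]) (use * in simp_all)
qed

lemma AE_lborel_component_notin_finite:
  fixes i :: "'n::finite"
  assumes "finite Z"
  shows "AE x in lborel. (x :: real^'n) $ i \<notin> Z"
proof -
  have "AE x in lborel. \<forall>z\<in>Z. x $ i \<noteq> z"
    using AE_lborel_inner_neq[of "axis i (1::real)"] assms
    by (subst AE_finite_all) (simp_all add: inner_axis)
  then show ?thesis by eventually_elim auto
qed

text \<open>The kinks of the factors lie on finitely many hyperplanes orthogonal to coordinate axes,
  which are null sets; elsewhere the product rule applies.\<close>

lemma ae_grad_product:
  fixes i j :: "'n::finite"
  assumes f: "pw_deriv f f'" and g: "pw_deriv g g'"
  shows "ae_grad (\<lambda>x::real^'n. f (x$i) * g (x$j))
    (\<lambda>x. (f' (x$i) * g (x$j)) *\<^sub>R axis i 1 + (f (x$i) * g' (x$j)) *\<^sub>R axis j 1)"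
proof -
  obtain Lf Bf Bf' Zf where F: "Lf-lipschitz_on UNIV f" "\<And>t. \<bar>f t\<bar> \<le> Bf" "\<And>t. \<bar>f' t\<bar> \<le> Bf'"
    "finite Zf" "\<And>t. t \<notin> Zf \<Longrightarrow> (f has_real_derivative f' t) (at t)"
    using pw_derivE[OF f] by blast
  obtain Lg Bg Bg' Zg where G: "Lg-lipschitz_on UNIV g" "\<And>t. \<bar>g t\<bar> \<le> Bg" "\<And>t. \<bar>g' t\<bar> \<le> Bg'"
    "finite Zg" "\<And>t. t \<notin> Zg \<Longrightarrow> (g has_real_derivative g' t) (at t)"
    using pw_derivE[OF g] by blast
  have [measurable]: "f \<in> borel_measurable borel" "g \<in> borel_measurable borel"
    "f' \<in> borel_measurable borel" "g' \<in> borel_measurable borel"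
    using f g lipschitz_on_continuous_on[OF F(1)] lipschitz_on_continuous_on[OF G(1)]
    by (auto simp: pw_deriv_def intro: borel_measurable_continuous_onI)
  have nn: "0 \<le> Bf" "0 \<le> Bg" "0 \<le> Bf'" "0 \<le> Bg'" "0 \<le> Lf" "0 \<le> Lg"
    using F(2)[of 0] F(3)[of 0] G(2)[of 0] G(3)[of 0] lipschitz_on_nonneg[OF F(1)] lipschitz_on_nonneg[OF G(1)]
    by linarith+
  have "(Bg * Lf + Bf * Lg)-lipschitz_on UNIV (\<lambda>x::real^'n. f (x$i) * g (x$j))"
  proof (rule lipschitz_onI)
    fix x y :: "real^'n"
    have c: "\<bar>x$k - y$k\<bar> \<le> dist x y" for k
      using component_le_norm_cart[of "x - y" k] by (simp add: dist_norm)
    have "\<bar>f (x$i) - f (y$i)\<bar> \<le> Lf * \<bar>x$i - y$i\<bar>" "\<bar>g (x$j) - g (y$j)\<bar> \<le> Lg * \<bar>x$j - y$j\<bar>"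
      using lipschitz_onD[OF F(1), of "x$i" "y$i"] lipschitz_onD[OF G(1), of "x$j" "y$j"]
      by (auto simp: dist_real_def)
    then have d: "\<bar>f (x$i) - f (y$i)\<bar> \<le> Lf * dist x y" "\<bar>g (x$j) - g (y$j)\<bar> \<le> Lg * dist x y"
      using mult_left_mono[OF c[of i] nn(5)] mult_left_mono[OF c[of j] nn(6)] by linarith+
    have "f (x$i) * g (x$j) - f (y$i) * g (y$j) = g (x$j) * (f (x$i) - f (y$i)) + f (y$i) * (g (x$j) - g (y$j))"
      by (simp add: algebra_simps)
    then have "\<bar>f (x$i) * g (x$j) - f (y$i) * g (y$j)\<bar> \<le> \<bar>g (x$j)\<bar> * \<bar>f (x$i) - f (y$i)\<bar> + \<bar>f (y$i)\<bar> * \<bar>g (x$j) - g (y$j)\<bar>"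
      by (metis abs_mult abs_triangle_ineq)
    also have "\<dots> \<le> Bg * (Lf * dist x y) + Bf * (Lg * dist x y)"
      by (intro add_mono mult_mono d F(2) G(2)) (use nn in auto)
    finally show "dist (f (x$i) * g (x$j)) (f (y$i) * g (y$j)) \<le> (Bg * Lf + Bf * Lg) * dist x y"
      by (simp add: dist_real_def algebra_simps)
  qed (use nn in auto)
  moreover have "bounded (range (\<lambda>x::real^'n. (f' (x$i) * g (x$j)) *\<^sub>R axis i 1 + (f (x$i) * g' (x$j)) *\<^sub>R (axis j 1 :: real^'n)))"
  proof -
    have "norm ((f' (x$i) * g (x$j)) *\<^sub>R axis i 1 + (f (x$i) * g' (x$j)) *\<^sub>R (axis j 1 :: real^'n)) \<le> Bf' * Bg + Bf * Bg'"
      for x :: "real^'n"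
    proof -
      have "\<bar>f' (x$i) * g (x$j)\<bar> \<le> Bf' * Bg" "\<bar>f (x$i) * g' (x$j)\<bar> \<le> Bf * Bg'"
        unfolding abs_mult by (intro mult_mono F(2,3) G(2,3) nn abs_ge_zero)+
      then show ?thesis by (intro norm_triangle_le) simp
    qed
    then show ?thesis by (auto simp: bounded_iff)
  qed
  moreover have "AE x::real^'n in lborel. x$i \<notin> Zf" "AE x::real^'n in lborel. x$j \<notin> Zg"
    using F G by (auto intro: AE_lborel_component_notin_finite)
  then have "AE x::real^'n in lborel. ((\<lambda>x. f (x$i) * g (x$j)) has_derivative
     (\<lambda>v. ((f' (x$i) * g (x$j)) *\<^sub>R axis i 1 + (f (x$i) * g' (x$j)) *\<^sub>R axis j 1) \<bullet> v)) (at x)"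
  proof eventually_elim
    case (elim x)
    have nth: "((\<lambda>x::real^'n. x$k) has_derivative (\<lambda>v. v$k)) (at x)" for k
      by (rule bounded_linear_imp_has_derivative) (rule bounded_linear_vec_nth)
    have "((\<lambda>x. f (x$i)) has_derivative (\<lambda>v. f' (x$i) * v$i)) (at x)"
      by (rule has_derivative_compose[OF nth F(5)[OF elim(1), unfolded has_field_derivative_def]])
    moreover have "((\<lambda>x. g (x$j)) has_derivative (\<lambda>v. g' (x$j) * v$j)) (at x)"
      by (rule has_derivative_compose[OF nth G(5)[OF elim(2), unfolded has_field_derivative_def]])
    ultimately have "((\<lambda>x. f (x$i) * g (x$j)) has_derivative (\<lambda>v. f (x$i) * (g' (x$j) * v$j) + f' (x$i) * v$i * g (x$j))) (at x)"
      by (rule has_derivative_mult)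
    then show ?case by (simp add: inner_add_left inner_axis' mult_ac add.commute)
  qed
  ultimately show ?thesis by (auto simp: ae_grad_def)
qed

subsection \<open>Rank-one concavity\<close>

text \<open>A state collects the gradient of \<open>u\<close> and the gradient of a stream function,
  whose rotation is the divergence-free field.\<close>

type_synonym state = "(real^2) \<times> (real^2)"

text \<open>Here \<open>m\<close> bounds from below the mean of \<open>f\<close> over
  \<open>S\<close> when the affine pair with gradients \<open>Z\<close> is perturbed inside
  \<open>S\<close>. The gradient fields vanish off \<open>S\<close> as well, so that perturbations
  on disjoint sets can be added without interfering.\<close>

definition attains :: "(state \<Rightarrow> real) \<Rightarrow> state \<Rightarrow> real \<Rightarrow> (real^2) set \<Rightarrow> bool" where
  "attains f Z m S \<longleftrightarrow> (\<exists>\<phi> G \<psi> H. ae_grad \<phi> G \<and> ae_grad \<psi> H \<and>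
     (\<forall>x. x \<notin> S \<longrightarrow> \<phi> x = 0 \<and> G x = 0 \<and> \<psi> x = 0 \<and> H x = 0) \<and>
     m * measure lborel S \<le> (LINT x:S|lborel. f (Z + (G x, H x))))"

lemma borel_measurable_state:
  assumes f: "continuous_on UNIV (f :: state \<Rightarrow> real)" and "ae_grad \<phi> G" "ae_grad \<psi> H"
  shows "(\<lambda>x. f (Z + (G x, H x))) \<in> borel_measurable borel"
proof -
  note [measurable] = ae_grad_measurable(2)[OF assms(2)] ae_grad_measurable(2)[OF assms(3)]
  have [measurable]: "f \<in> borel_measurable borel" using f by (rule borel_measurable_continuous_onI)
  have [measurable]: "(\<lambda>z. Z + z) \<in> borel_measurable borel"
    by (intro borel_measurable_continuous_onI continuous_intros)
  have "(\<lambda>x. (G x, H x)) \<in> borel_measurable borel" by (rule borel_measurable_Pair) measurable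
  then show ?thesis by (measurable)
qed

lemma bounded_state:
  assumes f: "continuous_on UNIV (f :: state \<Rightarrow> real)" and "ae_grad \<phi> G" "ae_grad \<psi> H"
  obtains B where "\<And>x. \<bar>f (Z + (G x, H x))\<bar> \<le> B"
proof -
  obtain BG BH where b: "\<And>x. norm (G x) \<le> BG" "\<And>x. norm (H x) \<le> BH"
    using ae_grad_bound[OF assms(2)] ae_grad_bound[OF assms(3)] by metis
  have c: "compact (f ` (\<lambda>z. Z + z) ` (cball 0 BG \<times> cball 0 BH))"
    by (intro compact_continuous_image continuous_intros compact_Times compact_cball
        continuous_on_subset[OF f]) auto
  obtain B where "\<forall>y\<in>f ` (\<lambda>z. Z + z) ` (cball 0 BG \<times> cball 0 BH). norm y \<le> B"
    using compact_imp_bounded[OF c] by (auto simp: bounded_iff)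
  then show thesis using b by (intro that[of B]) auto
qed

lemma set_integrable_state:
  assumes f: "continuous_on UNIV (f :: state \<Rightarrow> real)" and G: "ae_grad \<phi> G" and H: "ae_grad \<psi> H"
    and S: "S \<in> sets borel" "bounded S"
  shows "set_integrable lborel S (\<lambda>x. f (Z + (G x, H x)))"
proof -
  obtain B where "\<And>x. \<bar>f (Z + (G x, H x))\<bar> \<le> B" using bounded_state[OF f G H] by blast
  then show ?thesis unfolding set_integrable_def
    using S borel_measurable_state[OF f G H] emeasure_bounded_finite[OF S(2)]
    by (intro integrableI_bounded_set_indicator[where B=B]) auto
qed

text \<open>The base perturbation turns the state \<open>Z\<close> into \<open>Z1\<close> on
  \<open>S1\<close> and into \<open>Z2\<close> on \<open>S2\<close>, where the given perturbations
  are inserted. On the rest of \<open>S\<close> only the bound \<open>- C\<close> is available, and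
  \<open>m\<close> pays for that area.\<close>

lemma attains_glue:
  fixes f :: "state \<Rightarrow> real"
  assumes f: "continuous_on UNIV f"
    and S: "S \<in> sets borel" "bounded S" "S1 \<in> sets borel" "S2 \<in> sets borel" "S1 \<subseteq> S" "S2 \<subseteq> S" "S1 \<inter> S2 = {}"
    and a1: "attains f Z1 m1 S1" and a2: "attains f Z2 m2 S2"
    and 0: "ae_grad \<phi>0 G0" "ae_grad \<psi>0 H0"
    and out: "\<And>x. x \<notin> S \<Longrightarrow> \<phi>0 x = 0 \<and> G0 x = 0 \<and> \<psi>0 x = 0 \<and> H0 x = 0"
    and Z1: "\<And>x. x \<in> S1 \<Longrightarrow> Z + (G0 x, H0 x) = Z1"
    and Z2: "\<And>x. x \<in> S2 \<Longrightarrow> Z + (G0 x, H0 x) = Z2"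
    and lower: "\<And>x. x \<in> S - (S1 \<union> S2) \<Longrightarrow> - C \<le> f (Z + (G0 x, H0 x))"
    and m: "m * measure lborel S \<le> m1 * measure lborel S1 + m2 * measure lborel S2
      - C * (measure lborel S - measure lborel S1 - measure lborel S2)"
  shows "attains f Z m S"
proof -
  obtain \<phi>1 G1 \<psi>1 H1 where 1: "ae_grad \<phi>1 G1" "ae_grad \<psi>1 H1"
    "\<And>x. x \<notin> S1 \<Longrightarrow> \<phi>1 x = 0 \<and> G1 x = 0 \<and> \<psi>1 x = 0 \<and> H1 x = 0"
    "m1 * measure lborel S1 \<le> (LINT x:S1|lborel. f (Z1 + (G1 x, H1 x)))"
    using a1 unfolding attains_def by blast
  obtain \<phi>2 G2 \<psi>2 H2 where 2: "ae_grad \<phi>2 G2" "ae_grad \<psi>2 H2"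
    "\<And>x. x \<notin> S2 \<Longrightarrow> \<phi>2 x = 0 \<and> G2 x = 0 \<and> \<psi>2 x = 0 \<and> H2 x = 0"
    "m2 * measure lborel S2 \<le> (LINT x:S2|lborel. f (Z2 + (G2 x, H2 x)))"
    using a2 unfolding attains_def by blast
  define \<phi> where "\<phi> x = \<phi>0 x + \<phi>1 x + \<phi>2 x" for x
  define \<psi> where "\<psi> x = \<psi>0 x + \<psi>1 x + \<psi>2 x" for x
  define G where "G x = G0 x + G1 x + G2 x" for x
  define H where "H x = H0 x + H1 x + H2 x" for x
  have g: "ae_grad \<phi> G" "ae_grad \<psi> H"
    unfolding \<phi>_def[abs_def] \<psi>_def[abs_def] G_def[abs_def] H_def[abs_def]
    by (intro ae_grad_add 0 1(1,2) 2(1,2))+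
  have supp: "\<phi> x = 0 \<and> G x = 0 \<and> \<psi> x = 0 \<and> H x = 0" if "x \<notin> S" for x
  proof -
    have "x \<notin> S1" "x \<notin> S2" using that S by auto
    then show ?thesis using out[OF that] 1(3) 2(3) by (simp add: \<phi>_def \<psi>_def G_def H_def)
  qed
  let ?f = "\<lambda>x. f (Z + (G x, H x))"
  define T where "T = S - (S1 \<union> S2)"
  have T: "T \<in> sets borel" using S by (auto simp: T_def)
  have b: "bounded S1" "bounded S2" "bounded T" using S by (auto simp: T_def intro: bounded_subset)
  have int: "set_integrable lborel U ?f" if "U \<in> sets borel" "bounded U" for U
    using that by (rule set_integrable_state[OF f g])
  have fin: "U \<in> fmeasurable lborel" if "U \<in> sets borel" "bounded U" for U
    using that emeasure_bounded_finite by (auto simp: fmeasurable_def)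
  have dec: "S = (S1 \<union> S2) \<union> T" using S by (auto simp: T_def)
  have mT: "measure lborel T = measure lborel S - measure lborel S1 - measure lborel S2"
  proof -
    have "measure lborel T = measure lborel S - measure lborel (S1 \<union> S2)"
      unfolding T_def using S b by (intro measure_Diff) (use emeasure_bounded_finite[OF S(2)] in auto)
    also have "measure lborel (S1 \<union> S2) = measure lborel S1 + measure lborel S2"
      using S fin b by (intro measure_Un3[THEN trans]) auto
    finally show ?thesis by simp
  qed
  have i1: "(LINT x:S1|lborel. ?f x) = (LINT x:S1|lborel. f (Z1 + (G1 x, H1 x)))"
  proof (rule set_lebesgue_integral_cong, use S in simp, intro allI impI)
    fix x assume x: "x \<in> S1"
    then have "x \<notin> S2" using S by auto
    then have "Z + (G x, H x) = Z + (G0 x, H0 x) + (G1 x, H1 x)"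
      using 2(3)[of x] by (simp add: G_def H_def)
    then show "?f x = f (Z1 + (G1 x, H1 x))" by (simp only: Z1[OF x])
  qed
  have i2: "(LINT x:S2|lborel. ?f x) = (LINT x:S2|lborel. f (Z2 + (G2 x, H2 x)))"
  proof (rule set_lebesgue_integral_cong, use S in simp, intro allI impI)
    fix x assume x: "x \<in> S2"
    then have "x \<notin> S1" using S by auto
    then have "Z + (G x, H x) = Z + (G0 x, H0 x) + (G2 x, H2 x)"
      using 1(3)[of x] by (simp add: G_def H_def)
    then show "?f x = f (Z2 + (G2 x, H2 x))" by (simp only: Z2[OF x])
  qed
  have "- C * measure lborel T = (LINT x:T|lborel. - C)"
    by (simp add: set_lebesgue_integral_def)
  also have "\<dots> \<le> (LINT x:T|lborel. ?f x)"
  proof (rule set_integral_mono)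
    show "set_integrable lborel T (\<lambda>x. - C)"
      using T emeasure_bounded_finite[OF b(3)] by (simp add: set_integrable_def)
    show "- C \<le> ?f x" if "x \<in> T" for x
    proof -
      have "G x = G0 x" "H x = H0 x" using that 1(3)[of x] 2(3)[of x] by (auto simp: T_def G_def H_def)
      then show ?thesis using lower[of x] that by (simp add: T_def)
    qed
  qed (use int T b in auto)
  finally have iT: "- C * measure lborel T \<le> (LINT x:T|lborel. ?f x)" .
  have "(LINT x:S|lborel. ?f x) = (LINT x:S1 \<union> S2|lborel. ?f x) + (LINT x:T|lborel. ?f x)"
    unfolding dec using S T b by (intro set_integral_Un int) (auto simp: T_def)
  also have "(LINT x:S1 \<union> S2|lborel. ?f x) = (LINT x:S1|lborel. ?f x) + (LINT x:S2|lborel. ?f x)"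
    using S b by (intro set_integral_Un int) auto
  finally have "m * measure lborel S \<le> (LINT x:S|lborel. ?f x)"
    using 1(4) 2(4) iT m unfolding i1 i2 mT by linarith
  then show ?thesis using g supp unfolding attains_def by blast
qed

text \<open>This treats both coordinate directions at once: indices of type \<open>2\<close> are
  counted modulo 2, so \<open>i + 1\<close> is always the other coordinate.\<close>

definition coord_vec :: "2 \<Rightarrow> real \<Rightarrow> real \<Rightarrow> real^2" where
  "coord_vec i s t = (\<chi> k. if k = i then s else t)"

lemma coord_vec_nth [simp]: "coord_vec i s t $ i = s" "coord_vec i s t $ (i + 1) = t"
  using exhaust_2[of i] by (auto simp: coord_vec_def)

lemma two_plus_one: "(2::2) + 1 = 1" "(3::2) = 1"
proof -
  have "(2::2) + 1 \<noteq> 2" by (metis add_cancel_right_right zero_neq_one)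
  then show "(2::2) + 1 = 1" using exhaust_2[of "2 + 1"] by blast
  then show "(3::2) = 1" by simp
qed

lemma forall_2_shift: "(\<forall>k::2. P k) \<longleftrightarrow> P i \<and> P (i + 1)"
proof (cases "i = 1")
  case False
  then have "i = 2" using exhaust_2[of i] by blast
  then show ?thesis unfolding forall_2 by (metis two_plus_one(1))
qed (simp add: forall_2)

lemma coord_vec_components: "a = coord_vec i (a $ i) (a $ (i + 1))"
  by (simp add: vec_eq_iff forall_2_shift[of _ i])

lemma mem_box_coord_vec: "x \<in> box (coord_vec i s t) (coord_vec i s' t') \<longleftrightarrow> s < x$i \<and> x$i < s' \<and> t < x$(i+1) \<and> x$(i+1) < t'"
  by (auto simp: mem_box_cart forall_2_shift[of _ i])

lemma measure_box_coord_vec: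
  assumes "s \<le> s'" "t \<le> t'"
  shows "measure lborel (box (coord_vec i s t) (coord_vec i s' t')) = (s' - s) * (t' - t)"
proof -
  have "measure lborel (box (coord_vec i s t) (coord_vec i s' t')) = measure lborel (cbox (coord_vec i s t) (coord_vec i s' t'))"
    by (simp add: measure_lborel_box_eq measure_lborel_cbox_eq)
  also have "\<dots> = (\<Prod>k\<in>UNIV. coord_vec i s' t' $ k - coord_vec i s t $ k)"
    by (subst content_cbox_cart) (use assms in \<open>simp_all add: interval_ne_empty_cart forall_2_shift[of _ i]\<close>)
  also have "\<dots> = (s' - s) * (t' - t)"
  proof -
    let ?F = "\<lambda>k. coord_vec i s' t' $ k - coord_vec i s t $ k"
    have U: "UNIV = {i, i + 1}" using forall_2_shift[of "\<lambda>k. k \<in> {i, i+1}" i] by auto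
    have "i \<noteq> i + 1" using exhaust_2[of i] by auto
    then have "prod ?F UNIV = ?F i * ?F (i + 1)" unfolding U by (subst prod.insert) auto
    then show ?thesis by simp
  qed
  finally show ?thesis .
qed

text \<open>Admitting boxes of every shape lets a construction be repeated inside the pieces of
  another one. The strict \<open>m' < m\<close> absorbs the loss in transition layers.\<close>

definition achieves :: "(state \<Rightarrow> real) \<Rightarrow> state \<Rightarrow> real \<Rightarrow> bool" where
  "achieves f Z m \<longleftrightarrow> (\<forall>a b. (\<forall>k. a $ k < b $ k) \<longrightarrow> (\<forall>m'<m. attains f Z m' (box a b)))"

lemma ae_grad_zero: "ae_grad (\<lambda>_. 0) (\<lambda>_. 0)"
  using ae_grad_linear[of 0] by simp

lemma achieves_const: "achieves f Z (f Z)"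
  unfolding achieves_def attains_def
proof (intro allI impI)
  fix a b :: "real^2" and m assume m: "m < f Z"
  have "(LINT x:box a b|lborel. f (Z + (0, 0))) = f Z * measure lborel (box a b)"
    by (simp add: set_lebesgue_integral_def flip: zero_prod_def)
  moreover have "m * measure lborel (box a b) \<le> f Z * measure lborel (box a b)"
    using m by (intro mult_right_mono) auto
  ultimately show "\<exists>\<phi> G \<psi> H. ae_grad \<phi> G \<and> ae_grad \<psi> H \<and>
     (\<forall>x. x \<notin> box a b \<longrightarrow> \<phi> x = 0 \<and> G x = 0 \<and> \<psi> x = 0 \<and> H x = 0) \<and>
     m * measure lborel (box a b) \<le> (LINT x:box a b|lborel. f (Z + (G x, H x)))"
    by (intro exI[of _ "\<lambda>_. 0"] conjI ae_grad_zero) auto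
qed

lemma achieves_mono: "achieves f Z m \<Longrightarrow> m' \<le> m \<Longrightarrow> achieves f Z m'"
  by (auto simp: achieves_def)

text \<open>The base perturbation is zero: the two pieces fill the box up to a segment of measure
  zero, so the bound on the rest costs nothing.\<close>

lemma attains_bisect:
  assumes f: "continuous_on UNIV f"
    and ab: "s < p" "p < s'" "t < t'"
    and 1: "attains f Z m (box (coord_vec i s t) (coord_vec i p t'))" and 2: "attains f Z m (box (coord_vec i p t) (coord_vec i s' t'))"
  shows "attains f Z m (box (coord_vec i s t) (coord_vec i s' t'))"
proof (rule attains_glue[OF f _ _ _ _ _ _ _ 1 2 ae_grad_zero ae_grad_zero, where C="\<bar>f Z\<bar>"])
  show "m * measure lborel (box (coord_vec i s t) (coord_vec i s' t')) \<le> m * measure lborel (box (coord_vec i s t) (coord_vec i p t')) +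
      m * measure lborel (box (coord_vec i p t) (coord_vec i s' t')) - \<bar>f Z\<bar> * (measure lborel (box (coord_vec i s t) (coord_vec i s' t')) -
      measure lborel (box (coord_vec i s t) (coord_vec i p t')) - measure lborel (box (coord_vec i p t) (coord_vec i s' t')))"
    using ab by (simp add: measure_box_coord_vec algebra_simps)
qed (use ab in \<open>auto simp: mem_box_coord_vec simp flip: zero_prod_def\<close>)

text \<open>A tooth in direction \<open>i\<close>, cut off transversally over layers as thick as the box is
  wide, has the required gradients off these layers and a gradient of norm at most \<open>2\<close> on them.\<close>

lemma attains_thin:
  fixes A B :: real
  assumes f: "continuous_on UNIV f" and l: "0 < l" "l < 1"
    and Z: "Z = Z2 + l *\<^sub>R (A *\<^sub>R axis i 1, B *\<^sub>R axis i 1)" "Z1 = Z2 + (A *\<^sub>R axis i 1, B *\<^sub>R axis i 1)"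
    and 1: "achieves f Z1 m1" and 2: "achieves f Z2 m2" and m: "m < l * m1 + (1 - l) * m2"
  obtains r where "0 < r" "\<And>s s' t t'. s < s' \<Longrightarrow> t < t' \<Longrightarrow> s' - s \<le> r * (t' - t) \<Longrightarrow>
    attains f Z m (box (coord_vec i s t) (coord_vec i s' t'))"
proof -
  \<comment> \<open>The gradient of the tooth will have norm at most 2, so \<open>K\<close> contains
    every value of \<open>f\<close> that occurs on the cut-off layers, and \<open>C\<close> limits
    the damage there.\<close>
  define K where "K = f ` (\<lambda>g. Z + (A *\<^sub>R g, B *\<^sub>R g)) ` cball 0 2"
  have "compact K" unfolding K_def
    by (intro compact_continuous_image continuous_intros compact_cball continuous_on_subset[OF f]) auto
  then obtain C where C: "\<forall>y\<in>K. norm y \<le> C" using compact_imp_bounded[of K] unfolding bounded_iff by blast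
  \<comment> \<open>Half of the slack: one share is given up on the inner boxes, which leaves the
    mean \<open>m + e\<close> there, and the other pays for the layers.\<close>
  define e where "e = (l * m1 + (1 - l) * m2 - m) / 2"
  have e: "0 < e" using m by (simp add: e_def)
  define D where "D = \<bar>m + e\<bar> + \<bar>C\<bar>"
  \<comment> \<open>The bound \<open>1/4\<close> yields \<open>4 * w \<le> h\<close>, which leaves
    room between the two layers; the other one yields \<open>2 * w * D \<le> e * h\<close>, which
    keeps their cost within the reserved share.\<close>
  define r where "r = min (1/4) (e / (2 * D + 1))"
  have "0 < 2 * D + 1" by (simp add: D_def add_nonneg_pos)
  then have r: "0 < r" using e by (simp add: r_def)
  show thesis
  proof (rule that[OF r])
    fix s s' t t' :: real
    assume st: "s < s'" "t < t'" "s' - s \<le> r * (t' - t)"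
    define w where "w = s' - s"
    define h where "h = t' - t"
    define p where "p = s + l * w"
    have w: "0 < w" "0 < h" using st by (auto simp: w_def h_def)
    have wr: "w \<le> r * h" using st by (simp add: w_def h_def)
    have r2: "r \<le> 1/4" "r \<le> e / (2 * D + 1)" unfolding r_def by (rule min.cobounded1, rule min.cobounded2)
    have "r * h \<le> 1/4 * h" using w r2 by (intro mult_right_mono) auto
    then have wh: "4 * w \<le> h" using wr by simp
    have "r * h \<le> e / (2 * D + 1) * h" using w r2 by (intro mult_right_mono) auto
    then have "w \<le> e * h / (2 * D + 1)" using wr by simp
    then have "w * (2 * D + 1) \<le> e * h" using \<open>0 < 2 * D + 1\<close> by (simp add: pos_le_divide_eq)
    then have wD: "2 * w * D \<le> e * h" using w by (simp add: algebra_simps)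
    have p: "s < p" "p < s'"
    proof -
      show "s < p" using w l by (simp add: p_def)
      have "l * w < 1 * w" using w l by (intro mult_strict_right_mono) auto
      then show "p < s'" by (simp add: p_def w_def)
    qed
    \<comment> \<open>With this height the tooth peaking at \<open>p\<close> has slopes
      \<open>1 - l\<close> and \<open>- l\<close>, the multiples of the jump that lead from
      \<open>Z\<close> to \<open>Z1\<close> and to \<open>Z2\<close>.\<close>
    define M where "M = l * (1 - l) * w"
    have M: "0 < M" using l w by (simp add: M_def)
    have slopes: "M / (p - s) = 1 - l" "M / (s' - p) = l"
    proof -
      show "M / (p - s) = 1 - l" using l w by (simp add: M_def p_def)
      have "s' - p = (1 - l) * w" by (simp add: p_def w_def algebra_simps)
      then show "M / (s' - p) = l" using l w by (simp add: M_def)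
    qed
    have Mw: "M \<le> w"
    proof -
      have "l * (1 - l) \<le> 1" using l by (intro mult_le_one) auto
      then show ?thesis using mult_right_mono[of "l * (1 - l)" 1 w] w by (simp add: M_def)
    qed
    let ?u = "trap M s p p s'" and ?u' = "trap' M s p p s'"
    let ?c = "trap 1 t (t + w) (t' - w) t'" and ?c' = "trap' 1 t (t + w) (t' - w) t'"
    have tw: "t < t + w" "t + w \<le> t' - w" "t' - w < t'" using w wh by (auto simp: h_def)
    note u_facts = trap_range[OF p(1) order_refl p(2) M] and c_facts = trap_range[OF tw zero_less_one]
    \<comment> \<open>One scalar tooth serves both components, scaled by \<open>A\<close> and by
      \<open>B\<close>: both gradients jump along \<open>axis i 1\<close>, which is the rank-one
      condition.\<close>
    define T where "T x = ?u (x$i) * ?c (x$(i+1))" for x :: "real^2"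
    define g :: "real^2 \<Rightarrow> real^2" where
      "g x = (?u' (x$i) * ?c (x$(i+1))) *\<^sub>R axis i 1 + (?u (x$i) * ?c' (x$(i+1))) *\<^sub>R axis (i+1) 1" for x
    have T: "ae_grad T g" unfolding T_def[abs_def] g_def[abs_def]
      by (intro ae_grad_product pw_deriv_trap p tw M order_refl zero_less_one)
    \<comment> \<open>On the layers the cut-off has slope \<open>1 / w\<close> up to sign, but the
      tooth is at most \<open>w\<close> high, so the product is bounded independently of the
      box.\<close>
    have g2: "norm (g x) \<le> 2" for x
    proof -
      have "\<bar>?u' (x$i)\<bar> \<le> 1" using l by (auto simp: trap'_def slopes)
      then have "\<bar>?u' (x$i) * ?c (x$(i+1))\<bar> \<le> 1 * 1"
        unfolding abs_mult using c_facts[of "x$(i+1)"] by (intro mult_mono) auto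
      moreover have "\<bar>?c' (x$(i+1))\<bar> \<le> 1 / w" using w by (auto simp: trap'_def)
      then have "\<bar>?u (x$i) * ?c' (x$(i+1))\<bar> \<le> w * (1 / w)"
        unfolding abs_mult using u_facts[of "x$i"] Mw w by (intro mult_mono) auto
      ultimately show ?thesis unfolding g_def using w by (intro norm_triangle_le) simp
    qed
    have out: "T x = 0 \<and> g x = 0" if "x \<notin> box (coord_vec i s t) (coord_vec i s' t')" for x
    proof -
      have "x$i \<le> s \<or> s' \<le> x$i \<or> x$(i+1) \<le> t \<or> t' \<le> x$(i+1)" using that by (auto simp: mem_box_coord_vec not_less)
      then consider "?u (x$i) = 0" "?u' (x$i) = 0" | "?c (x$(i+1)) = 0" "?c' (x$(i+1)) = 0"
        using trap_left[OF p(1) order_refl p(2) M] trap_right[OF p(1) order_refl p(2) M]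
          trap_left[OF tw zero_less_one] trap_right[OF tw zero_less_one] p tw
        unfolding trap'_def by (smt (verit))
      then show ?thesis by cases (auto simp: T_def g_def)
    qed
    let ?S1 = "box (coord_vec i s (t + w)) (coord_vec i p (t' - w))" and ?S2 = "box (coord_vec i p (t + w)) (coord_vec i s' (t' - w))"
    have inner: "?c (x$(i+1)) = 1" "?c' (x$(i+1)) = 0" if "t + w < x$(i+1)" "x$(i+1) < t' - w" for x :: "real^2"
      using that trap_mid[OF tw zero_less_one] by (auto simp: trap'_def)
    have g1: "g x = (1 - l) *\<^sub>R axis i 1" if "x \<in> ?S1" for x
      using that inner[of x] by (simp add: g_def mem_box_coord_vec trap'_def slopes)
    have g2': "g x = (- l) *\<^sub>R axis i 1" if "x \<in> ?S2" for x
      using that inner[of x] p by (simp add: g_def mem_box_coord_vec trap'_def slopes)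
    have tt: "t + w < t' - w" using wh w by (simp add: h_def)
    have a1: "attains f Z1 (m1 - e) ?S1"
      using 1 p tt e unfolding achieves_def by (auto simp: forall_2_shift[of _ i])
    have a2: "attains f Z2 (m2 - e) ?S2"
      using 2 p tt e unfolding achieves_def by (auto simp: forall_2_shift[of _ i])
    show "attains f Z m (box (coord_vec i s t) (coord_vec i s' t'))"
    proof (rule attains_glue[OF f _ _ _ _ _ _ _ a1 a2 ae_grad_scale[OF T, of A] ae_grad_scale[OF T, of B], where C=C])
      show "Z + (A *\<^sub>R g x, B *\<^sub>R g x) = Z1" if "x \<in> ?S1" for x
        unfolding g1[OF that] Z by (simp add: scaleR_prod_def algebra_simps)
      show "Z + (A *\<^sub>R g x, B *\<^sub>R g x) = Z2" if "x \<in> ?S2" for x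
        unfolding g2'[OF that] Z by (simp add: scaleR_prod_def zero_prod_def algebra_simps)
      show "- C \<le> f (Z + (A *\<^sub>R g x, B *\<^sub>R g x))" for x
      proof -
        have "f (Z + (A *\<^sub>R g x, B *\<^sub>R g x)) \<in> K"
          unfolding K_def using g2[of x] by (intro imageI) simp
        then show ?thesis using C by fastforce
      qed
      have me: "measure lborel (box (coord_vec i s t) (coord_vec i s' t')) = w * h"
        "measure lborel ?S1 = l * w * (h - 2 * w)" "measure lborel ?S2 = (1 - l) * w * (h - 2 * w)"
        using st p tt by (simp_all add: measure_box_coord_vec) (simp_all add: p_def w_def h_def algebra_simps)
      \<comment> \<open>The layers have area \<open>2 * w * w\<close>. Comparing
        \<open>m * w * h\<close> with \<open>(m + e) * w * (h - 2 * w) - 2 * C * w * w\<close>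
        reduces to this.\<close>
      have "w * (2 * w * (m + e + C)) \<le> w * (e * h)"
      proof (intro mult_left_mono)
        have "2 * w * (m + e + C) \<le> 2 * w * D"
          using w by (intro mult_left_mono) (auto simp: D_def)
        then show "2 * w * (m + e + C) \<le> e * h" using wD by simp
      qed (use w in simp)
      moreover have "(m1 - e) * (l * w * (h - 2 * w)) + (m2 - e) * ((1 - l) * w * (h - 2 * w)) = (m + e) * w * (h - 2 * w)"
      proof -
        have "l * m1 + (1 - l) * m2 - e = m + e" by (simp add: e_def field_simps)
        moreover have "(m1 - e) * (l * w * (h - 2 * w)) + (m2 - e) * ((1 - l) * w * (h - 2 * w)) =
           (l * m1 + (1 - l) * m2 - e) * (w * (h - 2 * w))" by algebra
        ultimately show ?thesis by simp
      qed
      ultimately show "m * measure lborel (box (coord_vec i s t) (coord_vec i s' t')) \<le> (m1 - e) * measure lborel ?S1 +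
         (m2 - e) * measure lborel ?S2 - C * (measure lborel (box (coord_vec i s t) (coord_vec i s' t')) -
         measure lborel ?S1 - measure lborel ?S2)"
        unfolding me by (simp add: algebra_simps)
    qed (use p w wh out in \<open>auto simp: mem_box_coord_vec h_def\<close>)
  qed
qed

text \<open>Halving a box in direction \<open>i\<close> sufficiently often makes it thin enough for \<open>attains_thin\<close>.\<close>

lemma achieves_rank_one:
  fixes A B :: real
  assumes f: "continuous_on UNIV f" and l: "0 < l" "l < 1"
    and Z: "Z = Z2 + l *\<^sub>R (A *\<^sub>R axis i 1, B *\<^sub>R axis i 1)" "Z1 = Z2 + (A *\<^sub>R axis i 1, B *\<^sub>R axis i 1)"
    and 1: "achieves f Z1 m1" and 2: "achieves f Z2 m2"
  shows "achieves f Z (l * m1 + (1 - l) * m2)"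
  unfolding achieves_def
proof (intro allI impI)
  fix a b :: "real^2" and m
  assume ab: "\<forall>k. a $ k < b $ k" and m: "m < l * m1 + (1 - l) * m2"
  obtain r where r: "0 < r" "\<And>s s' t t'. s < s' \<Longrightarrow> t < t' \<Longrightarrow> s' - s \<le> r * (t' - t) \<Longrightarrow>
    attains f Z m (box (coord_vec i s t) (coord_vec i s' t'))"
    using attains_thin[OF f l Z 1 2 m] by blast
  have *: "s < s' \<Longrightarrow> t < t' \<Longrightarrow> s' - s \<le> 2 ^ n * (r * (t' - t)) \<Longrightarrow> attains f Z m (box (coord_vec i s t) (coord_vec i s' t'))" for n s s' t t'
  proof (induction n arbitrary: s s')
    case 0
    then show ?case by (intro r) auto
  next
    case (Suc n)
    define p where "p = (s + s') / 2"
    have "s < p" "p < s'" using Suc.prems by (auto simp: p_def)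
    moreover have "p - s \<le> 2 ^ n * (r * (t' - t))" "s' - p \<le> 2 ^ n * (r * (t' - t))"
      using Suc.prems by (auto simp: p_def field_simps)
    ultimately show ?case using Suc by (intro attains_bisect[OF f, of s p s']) auto
  qed
  obtain n where "(b$i - a$i) / (r * (b$(i+1) - a$(i+1))) < 2 ^ n"
    using real_arch_pow[of 2] by auto
  then have "b$i - a$i \<le> 2 ^ n * (r * (b$(i+1) - a$(i+1)))"
    using r ab by (auto simp: field_simps)
  then have "attains f Z m (box (coord_vec i (a$i) (a$(i+1))) (coord_vec i (b$i) (b$(i+1))))"
    using ab by (intro *) auto
  then show "attains f Z m (box a b)" by (simp flip: coord_vec_components)
qed

subsection \<open>Weak gradients and divergences\<close>

lemma frechet_derivative_inner_gradient:
  assumes "f differentiable (at x)"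
  shows "frechet_derivative f (at x) v = gradient f x \<bullet> v"
proof -
  have lin: "linear (frechet_derivative f (at x))"
    using assms by (rule linear_frechet_derivative)
  have "frechet_derivative f (at x) v = frechet_derivative f (at x) (\<Sum>b\<in>Basis. (v \<bullet> b) *\<^sub>R b)"
    by (simp add: euclidean_representation)
  also have "\<dots> = (\<Sum>b\<in>Basis. (v \<bullet> b) * frechet_derivative f (at x) b)"
    using lin by (simp add: linear_sum linear_scale)
  also have "\<dots> = gradient f x \<bullet> v"
    unfolding gradient_def inner_sum_left
    by (intro sum.cong) (simp_all add: inner_commute mult.commute)
  finally show ?thesis .
qed

text \<open>A continuous gradient with compact support is bounded, so the function is Lipschitz.
  This brings test functions under \<open>ae_grad\<close>, where integration by parts is
  available.\<close>

lemma test_functionE: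
  assumes "\<phi> \<in> test_functions \<Omega>"
  obtains r where "ae_grad \<phi> (gradient \<phi>)"
    "\<And>x. (\<phi> has_derivative (\<lambda>v. gradient \<phi> x \<bullet> v)) (at x)"
    "\<And>x. x \<notin> \<Omega> \<Longrightarrow> \<phi> x = 0 \<and> gradient \<phi> x = 0"
    "\<And>x. r < norm x \<Longrightarrow> \<phi> x = 0 \<and> gradient \<phi> x = 0"
proof -
  obtain K where K: "compact K" "K \<subseteq> \<Omega>" "\<And>x. x \<notin> K \<Longrightarrow> \<phi> x = 0" and C: "\<And>k. C_k k \<phi>"
    using assms by (auto simp: test_functions_def)
  have diff: "\<phi> differentiable (at x)" for x using C[of "Suc 0"] by simp
  have D: "(\<phi> has_derivative (\<lambda>v. gradient \<phi> x \<bullet> v)) (at x)" for x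
  proof -
    have "frechet_derivative \<phi> (at x) = (\<lambda>v. gradient \<phi> x \<bullet> v)"
      using frechet_derivative_inner_gradient[OF diff] by blast
    then show ?thesis using diff[of x] unfolding frechet_derivative_works by simp
  qed
  have cont: "continuous_on UNIV (gradient \<phi>)"
    unfolding gradient_def[abs_def] using C[of "Suc 0"] by (intro continuous_intros) auto
  have zero: "gradient \<phi> x = 0" if "x \<notin> K" for x
  proof -
    have "(\<phi> has_derivative (\<lambda>_. 0)) (at x)"
      by (rule has_derivative_transform_within_open[of "\<lambda>_. 0" _ _ UNIV "- K"])
         (use K that compact_imp_closed[OF K(1)] in auto)
    then have "frechet_derivative \<phi> (at x) = (\<lambda>_. 0)" by (metis frechet_derivative_at)
    then show ?thesis by (simp add: gradient_def)
  qed
  have "compact (gradient \<phi> ` K)" using cont K by (intro compact_continuous_image) (auto intro: continuous_on_subset)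
  then obtain B where B: "\<forall>y\<in>gradient \<phi> ` K. norm y \<le> B"
    using compact_imp_bounded[of "gradient \<phi> ` K"] unfolding bounded_iff by blast
  have B': "norm (gradient \<phi> x) \<le> \<bar>B\<bar>" for x
    using B zero[of x] by (cases "x \<in> K") force+
  have "\<bar>B\<bar>-lipschitz_on UNIV \<phi>"
  proof (rule bounded_derivative_imp_lipschitz)
    show "onorm (\<lambda>v. gradient \<phi> x \<bullet> v) \<le> \<bar>B\<bar>" for x
    proof (rule onorm_le)
      fix v show "norm (gradient \<phi> x \<bullet> v) \<le> \<bar>B\<bar> * norm v"
        using Cauchy_Schwarz_ineq2[of "gradient \<phi> x" v] mult_right_mono[OF B'[of x], of "norm v"] by simp
    qed
  qed (use D in auto)
  then have "ae_grad \<phi> (gradient \<phi>)"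
    unfolding ae_grad_def using D cont B' by (auto intro: borel_measurable_continuous_onI simp: bounded_iff)
  moreover obtain r where r: "\<forall>x\<in>K. norm x \<le> r" using compact_imp_bounded[OF K(1)] unfolding bounded_iff by blast
  ultimately show thesis using K zero D by (intro that[of r]) (auto simp: not_le[symmetric])
qed

section \<open>Borel functions on Lebesgue subspaces\<close>

lemma borel_measurable_lebesgue_on:
  "h \<in> borel_measurable borel \<Longrightarrow> h \<in> borel_measurable (lebesgue_on S)"
  by (intro measurable_restrict_space1 measurable_completion) simp

lemma integral_lebesgue_on_borel:
  fixes h :: "'a::euclidean_space \<Rightarrow> 'b::{banach, second_countable_topology}"
  assumes "S \<in> sets borel" "h \<in> borel_measurable borel"
  shows "(LINT x|lebesgue_on S. h x) = (LINT x:S|lborel. h x)"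
proof -
  have "(LINT x|lebesgue_on S. h x) = (LINT x|lebesgue. indicator S x *\<^sub>R h x)"
    using assms by (intro integral_restrict_space) auto
  also have "\<dots> = (LINT x|lborel. indicator S x *\<^sub>R h x)"
    using assms by (intro integral_completion) (auto intro!: borel_measurable_scaleR borel_measurable_indicator)
  finally show ?thesis by (simp add: set_lebesgue_integral_def)
qed

lemma integral_lebesgue_on_support:
  fixes h :: "'a::euclidean_space \<Rightarrow> 'b::{banach, second_countable_topology}"
  assumes "S \<in> sets borel" "h \<in> borel_measurable borel" "\<And>x. x \<notin> S \<Longrightarrow> h x = 0"
  shows "(LINT x|lebesgue_on S. h x) = (LINT x|lborel. h x)"
  unfolding integral_lebesgue_on_borel[OF assms(1,2)] set_lebesgue_integral_def
  by (rule Bochner_Integration.integral_cong) (use assms(3) in \<open>auto simp: indicator_def\<close>)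

lemma locally_integrable_bounded:
  fixes h :: "'a::euclidean_space \<Rightarrow> 'b::euclidean_space"
  assumes h: "h \<in> borel_measurable borel" and B: "\<And>x. x \<in> \<Omega> \<Longrightarrow> norm (h x) \<le> B"
  shows "locally_integrable \<Omega> h"
  unfolding locally_integrable_def
proof (intro allI impI)
  fix K assume K: "compact K \<and> K \<subseteq> \<Omega>"
  then have "K \<in> sets borel" by (auto intro: borel_compact)
  have "integrable (lebesgue_on K) h \<longleftrightarrow> integrable lebesgue (\<lambda>x. indicator K x *\<^sub>R h x)"
    using K by (intro integrable_restrict_space) (auto simp: borel_compact)
  also have "\<dots> \<longleftrightarrow> integrable lborel (\<lambda>x. indicator K x *\<^sub>R h x)"
    using h \<open>K \<in> sets borel\<close> by (intro integrable_completion) (auto intro!: borel_measurable_scaleR borel_measurable_indicator)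
  also have "\<dots>"
    using h \<open>K \<in> sets borel\<close> K B emeasure_compact_finite[of K]
    by (intro integrableI_bounded_set_indicator[where B=B]) auto
  finally show "integrable (lebesgue_on K) h" .
qed

lemma L_infty_bounded:
  fixes h :: "'a::euclidean_space \<Rightarrow> 'b::euclidean_space"
  assumes h: "h \<in> borel_measurable borel" and B: "\<And>x. x \<in> \<Omega> \<Longrightarrow> norm (h x) \<le> B"
  shows "h \<in> L_infty \<Omega>"
  unfolding L_infty_def using borel_measurable_lebesgue_on[OF h, of \<Omega>] B
  by (auto intro!: exI[of _ B] AE_I2 simp: space_restrict_space)

text \<open>In each basis direction the identity is \<open>ae_grad_integral_by_parts\<close>; the
  integrals extend to the whole space because test functions and their gradients vanish off
  \<open>\<Omega>\<close>.\<close>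

lemma ae_grad_has_weak_gradient:
  fixes u :: "'a::euclidean_space \<Rightarrow> real"
  assumes u: "ae_grad u G" and \<Omega>: "open \<Omega>" "bounded \<Omega>"
  shows "has_weak_gradient \<Omega> u G"
  unfolding has_weak_gradient_def
proof (intro conjI ballI)
  note [measurable] = ae_grad_measurable(1,2)[OF u]
  obtain R where R: "\<forall>x\<in>\<Omega>. norm x \<le> R" using \<Omega> by (auto simp: bounded_iff)
  obtain B where B: "\<And>x. norm x \<le> R \<Longrightarrow> \<bar>u x\<bar> \<le> B" using ae_grad_bound_cball[OF u, of R] by blast
  obtain BG where BG: "\<And>x. norm (G x) \<le> BG" using ae_grad_bound[OF u] by blast
  show "locally_integrable \<Omega> u" using R B by (intro locally_integrable_bounded[where B=B]) auto
  show "locally_integrable \<Omega> G" using BG by (intro locally_integrable_bounded[where B=BG]) auto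
  fix \<phi> assume "\<phi> \<in> test_functions \<Omega>"
  then obtain r where \<phi>: "ae_grad \<phi> (gradient \<phi>)"
    "\<And>x. x \<notin> \<Omega> \<Longrightarrow> \<phi> x = 0 \<and> gradient \<phi> x = 0" "\<And>x. r < norm x \<Longrightarrow> \<phi> x = 0 \<and> gradient \<phi> x = 0"
    by (rule test_functionE) blast
  note [measurable] = ae_grad_measurable(1,2)[OF \<phi>(1)]
  obtain C where C: "\<And>x. norm x \<le> r \<Longrightarrow> \<bar>\<phi> x\<bar> \<le> C" using ae_grad_bound_cball[OF \<phi>(1), of r] by blast
  obtain D where D: "\<And>x. norm x \<le> r \<Longrightarrow> \<bar>u x\<bar> \<le> D" using ae_grad_bound_cball[OF u, of r] by blast
  obtain E where E: "\<And>x. norm (gradient \<phi> x) \<le> E" using ae_grad_bound[OF \<phi>(1)] by blast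
  have i1: "integrable lborel (\<lambda>x. u x *\<^sub>R gradient \<phi> x)"
  proof (rule integrable_bounded_support)
    show "norm (u x *\<^sub>R gradient \<phi> x) \<le> D * E" if "norm x \<le> r" for x
      unfolding norm_scaleR using D[OF that] E[of x] by (intro mult_mono) auto
  qed (use \<phi>(3) in auto)
  have i2: "integrable lborel (\<lambda>x. \<phi> x *\<^sub>R G x)"
  proof (rule integrable_bounded_support)
    show "norm (\<phi> x *\<^sub>R G x) \<le> C * BG" if "norm x \<le> r" for x
      unfolding norm_scaleR using C[OF that] BG[of x] by (intro mult_mono) auto
  qed (use \<phi>(3) in auto)
  have e1: "(LINT x|lebesgue_on \<Omega>. u x *\<^sub>R gradient \<phi> x) = (LINT x|lborel. u x *\<^sub>R gradient \<phi> x)"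
    using \<phi>(2) \<Omega> by (intro integral_lebesgue_on_support) auto
  have e2: "(LINT x|lebesgue_on \<Omega>. \<phi> x *\<^sub>R G x) = (LINT x|lborel. \<phi> x *\<^sub>R G x)"
    using \<phi>(2) \<Omega> by (intro integral_lebesgue_on_support) auto
  show "(LINT x|lebesgue_on \<Omega>. u x *\<^sub>R gradient \<phi> x) = - (LINT x|lebesgue_on \<Omega>. \<phi> x *\<^sub>R G x)"
    unfolding e1 e2
  proof (rule euclidean_eqI)
    fix b :: 'a
    have "(LINT x|lborel. u x *\<^sub>R gradient \<phi> x) \<bullet> b = (LINT x|lborel. u x * (gradient \<phi> x \<bullet> b))"
      using integral_inner_left[OF i1, of b] by simp
    also have "\<dots> = - (LINT x|lborel. (G x \<bullet> b) * \<phi> x)"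
      by (subst ae_grad_integral_by_parts[OF u \<phi>(1,3)]) auto
    also have "(LINT x|lborel. (G x \<bullet> b) * \<phi> x) = (LINT x|lborel. \<phi> x *\<^sub>R G x) \<bullet> b"
      using integral_inner_left[OF i2, of b] by (simp add: mult.commute)
    finally show "(LINT x|lborel. u x *\<^sub>R gradient \<phi> x) \<bullet> b = - (LINT x|lborel. \<phi> x *\<^sub>R G x) \<bullet> b" by simp
  qed
qed

lemma ae_grad_W1_infty:
  fixes u :: "'a::euclidean_space \<Rightarrow> real"
  assumes u: "ae_grad u G" and \<Omega>: "open \<Omega>" "bounded \<Omega>"
  shows "u \<in> W1_infty \<Omega>"
proof -
  obtain R where R: "\<forall>x\<in>\<Omega>. norm x \<le> R" using \<Omega> by (auto simp: bounded_iff)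
  obtain B where B: "\<And>x. norm x \<le> R \<Longrightarrow> \<bar>u x\<bar> \<le> B" using ae_grad_bound_cball[OF u, of R] by blast
  obtain BG where BG: "\<And>x. norm (G x) \<le> BG" using ae_grad_bound[OF u] by blast
  have "u \<in> L_infty \<Omega>" using R B ae_grad_measurable[OF u] by (intro L_infty_bounded[where B=B]) auto
  moreover have "G \<in> L_infty \<Omega>" using BG ae_grad_measurable[OF u] by (intro L_infty_bounded[where B=BG]) auto
  ultimately show ?thesis
    using ae_grad_has_weak_gradient[OF assms] by (auto simp: W1_infty_def)
qed

text \<open>The clockwise quarter turn; applied to the gradient of a stream function it yields a
  divergence-free field.\<close>

definition rot :: "real^2 \<Rightarrow> real^2" where
  "rot q = vector [q $ 2, - (q $ 1)]"

lemma continuous_rot: "continuous_on UNIV rot"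
proof -
  have eq: "rot = (\<lambda>q. (q $ 2) *\<^sub>R axis 1 1 + (- (q $ 1)) *\<^sub>R axis 2 1)"
    by (auto simp: rot_def vec_eq_iff forall_2 axis_def)
  show ?thesis unfolding eq by (intro continuous_intros)
qed

lemma norm_rot: "norm (rot q) = norm q"
  by (simp add: rot_def norm_eq_sqrt_inner inner_vec_def sum_2 add.commute)

text \<open>Paired with a test gradient, \<open>rot (H x)\<close> gives a difference of two mixed
  products of partial derivatives, whose integrals agree by
  \<open>ae_grad_integral_swap\<close>.\<close>

lemma div_eq_diff_rot_gradient:
  fixes V :: "real^2 \<Rightarrow> real^2"
  assumes V: "V \<in> borel_measurable borel" "\<And>x. norm (V x) \<le> B" and w: "ae_grad w H"
    and \<Omega>: "open \<Omega>"
  shows "div_eq \<Omega> V (\<lambda>x. V x - rot (H x))"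
  unfolding div_eq_def
proof (intro conjI ballI)
  note [measurable] = V(1) ae_grad_measurable(2)[OF w]
  have [measurable]: "rot \<in> borel_measurable borel"
    by (rule borel_measurable_continuous_onI[OF continuous_rot])
  obtain BH where BH: "\<And>x. norm (H x) \<le> BH" using ae_grad_bound[OF w] by blast
  have bound: "norm (V x - rot (H x)) \<le> B + BH" for x
    using norm_triangle_ineq4[of "V x" "rot (H x)"] V(2)[of x] BH[of x] by (simp add: norm_rot)
  show "locally_integrable \<Omega> V" by (rule locally_integrable_bounded[OF V])
  show "locally_integrable \<Omega> (\<lambda>x. V x - rot (H x))"
    by (rule locally_integrable_bounded[OF _ bound]) measurable
  fix \<phi> assume "\<phi> \<in> test_functions \<Omega>"
  then obtain r where \<phi>: "ae_grad \<phi> (gradient \<phi>)" "\<And>x. (\<phi> has_derivative (\<lambda>v. gradient \<phi> x \<bullet> v)) (at x)"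
    "\<And>x. x \<notin> \<Omega> \<Longrightarrow> \<phi> x = 0 \<and> gradient \<phi> x = 0" "\<And>x. r < norm x \<Longrightarrow> \<phi> x = 0 \<and> gradient \<phi> x = 0"
    by (rule test_functionE) blast
  note [measurable] = ae_grad_measurable(1,2)[OF \<phi>(1)]
  obtain E where E: "\<And>x. norm (gradient \<phi> x) \<le> E" using ae_grad_bound[OF \<phi>(1)] by blast
  have int: "integrable lborel (\<lambda>x. U x \<bullet> gradient \<phi> x)"
    if [measurable]: "U \<in> borel_measurable borel" and U: "\<And>x. norm (U x) \<le> M" for U M
  proof (rule integrable_bounded_support[of _ r "M * E"])
    show "norm (U x \<bullet> gradient \<phi> x) \<le> M * E" for x
      using Cauchy_Schwarz_ineq2[of "U x" "gradient \<phi> x"] mult_mono[OF U[of x] E[of x]] norm_ge_zero[of "U x"] U[of x]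
      by (simp add: order_trans[of 0 "norm (U x)" M])
  qed (use \<phi>(4) in auto)
  have int1: "integrable lborel (\<lambda>x. (H x \<bullet> b) * (gradient \<phi> x \<bullet> c))" for b c
  proof -
    have "integrable lborel (\<lambda>x. ((H x \<bullet> b) *\<^sub>R c) \<bullet> gradient \<phi> x)"
    proof (rule int)
      show "norm ((H x \<bullet> b) *\<^sub>R c) \<le> (BH * norm b) * norm c" for x
        unfolding norm_scaleR real_norm_def
        by (intro mult_right_mono order_trans[OF Cauchy_Schwarz_ineq2] BH) auto
    qed measurable
    then show ?thesis by (simp add: inner_commute[of c])
  qed
  have "rot (H x) \<bullet> gradient \<phi> x = (H x \<bullet> axis 2 1) * (gradient \<phi> x \<bullet> axis 1 1) - (H x \<bullet> axis 1 1) * (gradient \<phi> x \<bullet> axis 2 1)" for x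
    by (simp add: rot_def inner_vec_def sum_2 axis_def)
  then have z: "(LINT x|lborel. rot (H x) \<bullet> gradient \<phi> x) = 0"
    using ae_grad_integral_swap[OF w \<phi>(1,2,4), where b="axis 2 1" and c="axis 1 1"] by (simp add: int1)
  have "(LINT x|lborel. (V x - rot (H x)) \<bullet> gradient \<phi> x) = (LINT x|lborel. V x \<bullet> gradient \<phi> x)"
    using int[OF V] int[of "\<lambda>x. rot (H x)" BH] BH z by (simp add: inner_diff_left norm_rot)
  moreover have "(LINT x|lebesgue_on \<Omega>. U x \<bullet> gradient \<phi> x) = (LINT x|lborel. U x \<bullet> gradient \<phi> x)"
    if [measurable]: "U \<in> borel_measurable borel" for U
    using \<phi>(3) \<Omega> by (intro integral_lebesgue_on_support) auto
  ultimately show "dist_div \<Omega> V \<phi> = dist_div \<Omega> (\<lambda>x. V x - rot (H x)) \<phi>"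
    by (simp add: dist_div_def)
qed

subsection \<open>The staircase\<close>

lemma A_field_nth: "A_field \<theta> \<eta> $ i = (1 + sqrt \<theta> * sin (pi * \<eta> $ i)) * \<eta> $ i"
  using exhaust_2[of i] by (auto simp: A_field_def matrix_vector_mult_def sum_2)

lemma continuous_A_field: "continuous_on UNIV (A_field \<theta>)"
proof -
  have eq: "A_field \<theta> = (\<lambda>\<eta>. \<chi> i. (1 + sqrt \<theta> * sin (pi * \<eta> $ i)) * \<eta> $ i)"
    by (simp add: fun_eq_iff vec_eq_iff A_field_nth)
  show ?thesis unfolding eq by (intro continuous_intros)
qed

text \<open>The stream function varies in direction 2, so that \<open>rot\<close> turns its gradient
  into \<open>(y, 0)\<close>. Changing \<open>x\<close> is then a rank-one move in direction 1,
  changing \<open>y\<close> one in direction 2.\<close>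

definition diag_state :: "real \<Rightarrow> real \<Rightarrow> state" where
  "diag_state x y = (x *\<^sub>R axis 1 1, y *\<^sub>R axis 2 1)"

text \<open>The pointwise balance of the desired inequality for exponent 5 and
  \<open>\<theta> = 49/81\<close>, with the difference inside the second norm in the role of
  \<open>F\<close>. Its integral over the disc has to exceed \<open>\<Lambda>\<close>.\<close>

definition excess :: "real \<Rightarrow> state \<Rightarrow> real" where
  "excess \<Lambda> Z = norm (fst Z) ^ 5 - \<Lambda> * norm (A_field (49/81) (fst Z) - rot (snd Z)) ^ 5"

lemma continuous_excess: "continuous_on UNIV (excess \<Lambda>)"
  unfolding excess_def
  by (intro continuous_intros continuous_on_compose2[OF continuous_A_field] continuous_on_compose2[OF continuous_rot]) auto

text \<open>On these points the excess is nonnegative independently of \<open>\<Lambda>\<close>: the staircase below uses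
  no other endpoints.\<close>

lemma excess_on_graph:
  assumes "y = (1 + 7/9 * sin (pi * x)) * x"
  shows "excess \<Lambda> (diag_state x y) = \<bar>x\<bar> ^ 5"
proof -
  have "sqrt (49/81) = 7/9" by (simp add: real_sqrt_divide)
  then have "A_field (49/81) (x *\<^sub>R axis 1 1) = rot (y *\<^sub>R axis 2 1)"
    using assms by (simp add: vec_eq_iff forall_2 A_field_nth rot_def axis_def)
  then show ?thesis by (simp add: excess_def diag_state_def)
qed

lemma achieves_horizontal:
  assumes "0 < l" "l < 1" "x = l * x1 + (1 - l) * x2"
    and "achieves f (diag_state x1 y) m1" "achieves f (diag_state x2 y) m2" "continuous_on UNIV f"
  shows "achieves f (diag_state x y) (l * m1 + (1 - l) * m2)"
  by (rule achieves_rank_one[where A="x1 - x2" and B=0 and i=1, OF assms(6,1,2) _ _ assms(4,5)])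
     (simp_all add: diag_state_def assms(3) algebra_simps)

lemma achieves_vertical:
  assumes "0 < l" "l < 1" "y = l * y1 + (1 - l) * y2"
    and "achieves f (diag_state x y1) m1" "achieves f (diag_state x y2) m2" "continuous_on UNIV f"
  shows "achieves f (diag_state x y) (l * m1 + (1 - l) * m2)"
  by (rule achieves_rank_one[where A=0 and B="y1 - y2" and i=2, OF assms(6,1,2) _ _ assms(4,5)])
     (simp_all add: diag_state_def assms(3) algebra_simps)

text \<open>Since 5 is 1 modulo 4, multiplying a half-integer by \<open>5 ^ k\<close> shifts it by a
  multiple of 2, so the sine takes the same values at every stage.\<close>

lemma power5_mod4: "\<exists>j::nat. (5::real) ^ k = 4 * real j + 1"
proof (induction k)
  case (Suc k)
  then obtain j where "(5::real) ^ k = 4 * real j + 1" by blast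
  then have "(5::real) ^ Suc k = 4 * real (5 * j + 1) + 1" by simp
  then show ?case by blast
qed (auto intro: exI[of _ 0])

text \<open>The factor \<open>1 + 7/9 * sin (pi * x)\<close> is thus \<open>16/9\<close>,
  \<open>2/9\<close> and \<open>1\<close> at these three points, so the graph contains
  \<open>(9 t / 2, 8 t)\<close>, \<open>(47 t / 2, 47 t / 9)\<close> and
  \<open>(8 t, 8 t)\<close>.\<close>

lemma sin_graph_points:
  fixes k :: nat
  defines "t \<equiv> (5::real) ^ k"
  shows "sin (pi * (9/2 * t)) = 1" "sin (pi * (47/2 * t)) = - 1" "sin (pi * (8 * t)) = 0"
proof -
  obtain j :: nat where j: "t = 4 * real j + 1" using power5_mod4 unfolding t_def by blast
  have "sin (pi * (9/2 * t)) = sin (pi / 2 + 2 * real (9 * j + 2) * pi)"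
    unfolding j by (rule arg_cong[of _ _ sin]) (simp add: field_simps)
  then show "sin (pi * (9/2 * t)) = 1" unfolding sin_add cos_2npi sin_2npi by simp
  have "sin (pi * (47/2 * t)) = sin (3 / 2 * pi + 2 * real (47 * j + 11) * pi)"
    unfolding j by (rule arg_cong[of _ _ sin]) (simp add: field_simps)
  then show "sin (pi * (47/2 * t)) = - 1" unfolding sin_add cos_2npi sin_2npi sin_3over2_pi cos_3over2_pi by simp
  have "sin (pi * (8 * t)) = sin (2 * real (16 * j + 4) * pi)"
    unfolding j by (rule arg_cong[of _ _ sin]) (simp add: field_simps)
  then show "sin (pi * (8 * t)) = 0" unfolding sin_2npi .
qed

text \<open>One step with \<open>t = 5 ^ k\<close> splits \<open>(47 t / 10, 8 t)\<close> horizontally into \<open>(9 t / 2, 8 t)\<close> and, with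
  weight \<open>1 / 95\<close>, \<open>(47 t / 2, 8 t)\<close>; the latter vertically into \<open>(47 t / 2, 47 t / 9)\<close> and, with weight
  \<open>25 / 313\<close>, the next step \<open>(47 t / 2, 40 t)\<close>. The surviving weight \<open>5 / 5947\<close> is beaten by the
  growth \<open>5 ^ 5\<close> of the fifth power of the gradient.\<close>

lemma achieves_staircase:
  "achieves (excess \<Lambda>) (diag_state (47/10 * 5 ^ k) (8 * 5 ^ k)) ((15625/5947) ^ n * (9/2 * 5 ^ k) ^ 5)"
proof (induction n arbitrary: k)
  case 0
  let ?t = "(5::real) ^ k"
  \<comment> \<open>The staircase ends with a split into two graph points. Both have excess at least
    \<open>(9/2 * ?t) ^ 5\<close>, hence so does their average.\<close>
  have "excess \<Lambda> (diag_state (9/2 * ?t) (8 * ?t)) = (9/2 * ?t) ^ 5" "excess \<Lambda> (diag_state (8 * ?t) (8 * ?t)) = (8 * ?t) ^ 5"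
    using sin_graph_points[of k] by (subst excess_on_graph; simp)+
  then have "achieves (excess \<Lambda>) (diag_state (9/2 * ?t) (8 * ?t)) ((9/2 * ?t) ^ 5)"
    "achieves (excess \<Lambda>) (diag_state (8 * ?t) (8 * ?t)) ((8 * ?t) ^ 5)"
    by (metis achieves_const)+
  from achieves_horizontal[OF _ _ _ this continuous_excess, of "33/35" "47/10 * ?t"]
  have "achieves (excess \<Lambda>) (diag_state (47/10 * ?t) (8 * ?t)) (33/35 * (9/2 * ?t) ^ 5 + (1 - 33/35) * (8 * ?t) ^ 5)"
    by simp
  moreover have "(9/2 * ?t) ^ 5 \<le> (8 * ?t) ^ 5" by (intro power_mono) auto
  ultimately show ?case by (elim achieves_mono) simp
next
  case (Suc n)
  let ?t = "(5::real) ^ k" and ?M = "(15625/5947) ^ n * (9/2 * 5 ^ Suc k) ^ 5 :: real"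
  \<comment> \<open>These coordinates are \<open>47/10\<close> and \<open>8\<close> times
    \<open>5 ^ Suc k\<close>: the starting point of the next stage.\<close>
  have up: "achieves (excess \<Lambda>) (diag_state (47/2 * ?t) (40 * ?t)) ?M"
    using Suc[of "Suc k"] by (simp add: mult.assoc[symmetric])
  have "excess \<Lambda> (diag_state (47/2 * ?t) (47/9 * ?t)) = \<bar>47/2 * ?t\<bar> ^ 5" "excess \<Lambda> (diag_state (9/2 * ?t) (8 * ?t)) = \<bar>9/2 * ?t\<bar> ^ 5"
    using sin_graph_points[of k] by (intro excess_on_graph; simp)+
  \<comment> \<open>The mass that lands on the graph is only credited with 0; the surviving branch
    alone provides the growth.\<close>
  then have down: "achieves (excess \<Lambda>) (diag_state (47/2 * ?t) (47/9 * ?t)) 0" and left: "achieves (excess \<Lambda>) (diag_state (9/2 * ?t) (8 * ?t)) 0"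
    by (metis achieves_const achieves_mono abs_ge_zero zero_le_power)+
  have "achieves (excess \<Lambda>) (diag_state (47/2 * ?t) (8 * ?t)) (288/313 * 0 + (1 - 288/313) * ?M)"
    by (rule achieves_vertical[OF _ _ _ down up continuous_excess]) auto
  from achieves_horizontal[OF _ _ _ left this continuous_excess, of "94/95" "47/10 * ?t"]
  have *: "achieves (excess \<Lambda>) (diag_state (47/10 * ?t) (8 * ?t)) (94/95 * 0 + (1 - 94/95) * (288/313 * 0 + (1 - 288/313) * ?M))"
    by simp
  have "(9/2 * 5 ^ Suc k) ^ 5 = 3125 * (9/2 * ?t) ^ 5"
  proof -
    have "9/2 * 5 ^ Suc k = 5 * (9/2 * ?t)" by simp
    then show ?thesis by (simp only: power_mult_distrib[of 5]) simp
  qed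
  \<comment> \<open>The factor per stage is \<open>1/95 * 25/313 * 3125 = 15625/5947\<close>, which
    is greater than 1.\<close>
  then have eq: "94/95 * 0 + (1 - 94/95) * (288/313 * 0 + (1 - 288/313) * ?M) = (15625/5947) ^ Suc n * (9/2 * ?t) ^ 5"
    by (simp only: power_Suc) simp
  show ?case using * unfolding eq .
qed

section \<open>From the staircase to \<open>u\<close> and \<open>F\<close> on the disc\<close>

theorem theorem1p4:
  "\<exists>\<theta> pbar :: real. \<exists>l :: real^2 \<Rightarrow> real.
     0 < \<theta> \<and> \<theta> < 1 \<and> pbar > 2 \<and> linear l \<and>
     (\<forall>\<Lambda>>0. \<exists>(u :: real^2 \<Rightarrow> real) (G :: real^2 \<Rightarrow> real^2) (F :: real^2 \<Rightarrow> real^2).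
        (\<exists>L. L-lipschitz_on (cball 0 1) u) \<and>
        u \<in> W1_infty (ball 0 1) \<and>
        has_weak_gradient (ball 0 1) u G \<and>
        F \<in> L_infty (ball 0 1) \<and>
        div_eq (ball 0 1) (\<lambda>x. A_field \<theta> (G x)) F \<and>
        (\<forall>x\<in>sphere 0 1. u x = l x) \<and>
        (LINT x|lebesgue_on (ball 0 1). norm (G x) powr pbar)
          > \<Lambda> * (1 + (LINT x|lebesgue_on (ball 0 1). norm (F x) powr pbar)))"
proof -
  \<comment> \<open>The foot of the staircase, at \<open>k = 0\<close>. Its first component is the
    slope of the boundary datum, which therefore does not depend on
    \<open>\<Lambda>\<close>.\<close>
  define Z where "Z = diag_state (47/10) 8"
  have "\<exists>(u :: real^2 \<Rightarrow> real) (G :: real^2 \<Rightarrow> real^2) (F :: real^2 \<Rightarrow> real^2).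
        (\<exists>L. L-lipschitz_on (cball 0 1) u) \<and>
        u \<in> W1_infty (ball 0 1) \<and>
        has_weak_gradient (ball 0 1) u G \<and>
        F \<in> L_infty (ball 0 1) \<and>
        div_eq (ball 0 1) (\<lambda>x. A_field (49/81) (G x)) F \<and>
        (\<forall>x\<in>sphere 0 1. u x = fst Z \<bullet> x) \<and>
        (LINT x|lebesgue_on (ball 0 1). norm (G x) powr 5)
          > \<Lambda> * (1 + (LINT x|lebesgue_on (ball 0 1). norm (F x) powr 5))"
    for \<Lambda> :: real
  proof -
    let ?D = "ball 0 1 :: (real^2) set" and ?f = "excess \<Lambda>"
    \<comment> \<open>This exceeds \<open>\<Lambda>\<close> even after the unperturbed part of the
      disc has cost at most \<open>\<bar>?f Z\<bar> * measure lborel ?D\<close>.\<close>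
    define m where "m = \<Lambda> + \<bar>?f Z\<bar> * measure lborel ?D + 1"
    obtain n where n: "m < (15625/5947) ^ n" using real_arch_pow[of "15625/5947"] by auto
    also have "(15625/5947) ^ n \<le> (15625/5947) ^ n * ((9/2) ^ 5 :: real)" by simp
    finally have m: "m < (15625/5947) ^ n * (9/2 * 5 ^ 0) ^ 5" by simp
    \<comment> \<open>A square of area 1 inside the disc, so that the mean over \<open>S\<close>
      equals the integral and the boundary values stay linear.\<close>
    define S where "S = box (coord_vec 1 (-1/2) (-1/2)) (coord_vec 1 (1/2) (1/2))"
    have "achieves ?f Z ((15625/5947) ^ n * (9/2 * 5 ^ 0) ^ 5)"
      using achieves_staircase[of \<Lambda> 0 n] by (simp add: Z_def)
    moreover have "\<forall>k. coord_vec 1 (-1/2) (-1/2) $ k < coord_vec 1 (1/2) (1/2) $ k" by (simp add: coord_vec_def)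
    ultimately have att: "attains ?f Z m S" using m unfolding achieves_def S_def by metis
    obtain \<phi> G0 \<psi> H0 where 0: "ae_grad \<phi> G0" "ae_grad \<psi> H0"
      "\<And>x. x \<notin> S \<Longrightarrow> \<phi> x = 0 \<and> G0 x = 0 \<and> \<psi> x = 0 \<and> H0 x = 0"
      "m * measure lborel S \<le> (LINT x:S|lborel. ?f (Z + (G0 x, H0 x)))"
      using att unfolding attains_def by blast
    have mS: "measure lborel S = 1" unfolding S_def by (subst measure_box_coord_vec) auto
    have S: "S \<in> sets borel" "S \<subseteq> ?D"
    proof -
      show "S \<in> sets borel" by (simp add: S_def)
      show "S \<subseteq> ?D"
      proof
        fix x assume "x \<in> S"
        then have "\<bar>x$1\<bar> < 1/2" "\<bar>x$2\<bar> < 1/2" by (auto simp: S_def mem_box_coord_vec[of _ 1, simplified] abs_less_iff)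
        then have "norm x < 1"
          using norm_le_l1_cart[of x] by (simp add: sum_2)
        then show "x \<in> ?D" by simp
      qed
    qed
    define u where "u x = fst Z \<bullet> x + \<phi> x" for x
    define w where "w x = snd Z \<bullet> x + \<psi> x" for x
    define G where "G x = fst Z + G0 x" for x
    define H where "H x = snd Z + H0 x" for x
    define V where "V x = A_field (49/81) (G x)" for x
    define F where "F x = V x - rot (H x)" for x
    have u: "ae_grad u G" and w: "ae_grad w H"
      unfolding u_def[abs_def] w_def[abs_def] G_def[abs_def] H_def[abs_def]
      by (intro ae_grad_add ae_grad_linear 0)+
    note [measurable] = ae_grad_measurable(2)[OF u] ae_grad_measurable(2)[OF w]
    have [measurable]: "A_field (49/81) \<in> borel_measurable borel" "rot \<in> borel_measurable borel"
      by (intro borel_measurable_continuous_onI continuous_A_field continuous_rot)+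
    have [measurable]: "V \<in> borel_measurable borel" unfolding V_def[abs_def] by measurable
    have [measurable]: "F \<in> borel_measurable borel" unfolding F_def[abs_def] by measurable
    obtain BG where BG: "\<And>x. norm (G x) \<le> BG" using ae_grad_bound[OF u] by blast
    obtain BH where BH: "\<And>x. norm (H x) \<le> BH" using ae_grad_bound[OF w] by blast
    have "compact (A_field (49/81) ` cball 0 BG)"
      by (intro compact_continuous_image compact_cball continuous_on_subset[OF continuous_A_field]) auto
    then obtain BV where "\<forall>y\<in>A_field (49/81) ` cball 0 BG. norm y \<le> BV"
      using compact_imp_bounded[of "A_field (49/81) ` cball 0 BG"] unfolding bounded_iff by blast
    then have BV: "norm (V x) \<le> BV" for x using BG[of x] by (auto simp: V_def)
    have BF: "norm (F x) \<le> BV + BH" for x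
      using norm_triangle_ineq4[of "V x" "rot (H x)"] BV[of x] BH[of x] by (simp add: F_def norm_rot)
    have int: "set_integrable lborel A h" if "h \<in> borel_measurable borel" "\<And>x. \<bar>h x\<bar> \<le> B"
      "A \<in> sets borel" "A \<subseteq> ?D" for h :: "real^2 \<Rightarrow> real" and A B
      unfolding set_integrable_def
      using that emeasure_bounded_finite[of A] bounded_subset[OF bounded_ball that(4)]
      by (intro integrableI_bounded_set_indicator[where B=B]) auto
    have G5: "\<bar>norm (G x) ^ 5\<bar> \<le> BG ^ 5" and F5: "\<bar>norm (F x) ^ 5\<bar> \<le> (BV + BH) ^ 5" for x
      using BG[of x] BF[of x] by (auto intro: power_mono)
    have fx: "?f (Z + (G0 x, H0 x)) = norm (G x) ^ 5 - \<Lambda> * norm (F x) ^ 5" for x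
      by (simp add: excess_def F_def V_def G_def H_def)
    have intf: "set_integrable lborel A (\<lambda>x. ?f (Z + (G0 x, H0 x)))" if "A \<in> sets borel" "A \<subseteq> ?D" for A
      using that bounded_subset[OF bounded_ball that(2)] by (intro set_integrable_state[OF continuous_excess 0(1,2)]) auto
    \<comment> \<open>Off \<open>S\<close> the state is exactly \<open>Z\<close>, so the integrand
      is the constant \<open>?f Z\<close> there.\<close>
    have "- \<bar>?f Z\<bar> * measure lborel ?D \<le> - \<bar>?f Z\<bar> * measure lborel (?D - S)"
      using S emeasure_bounded_finite[OF bounded_ball, of 0 "1::real"]
      by (intro mult_left_mono_neg measure_mono_fmeasurable) (auto simp: fmeasurable_def)
    also have "\<dots> = (LINT x:?D - S|lborel. - \<bar>?f Z\<bar>)"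
      by (simp add: set_lebesgue_integral_def)
    also have "\<dots> \<le> (LINT x:?D - S|lborel. ?f (Z + (G0 x, H0 x)))"
    proof (rule set_integral_mono)
      show "set_integrable lborel (?D - S) (\<lambda>x. - \<bar>?f Z\<bar>)"
        using S by (intro int[where B="\<bar>?f Z\<bar>"]) auto
      show "- \<bar>?f Z\<bar> \<le> ?f (Z + (G0 x, H0 x))" if "x \<in> ?D - S" for x
      proof -
        have "Z + (G0 x, H0 x) = Z" using 0(3)[of x] that by (simp flip: zero_prod_def)
        then show ?thesis by simp
      qed
    qed (use S intf in auto)
    finally have out: "- \<bar>?f Z\<bar> * measure lborel ?D \<le> (LINT x:?D - S|lborel. ?f (Z + (G0 x, H0 x)))" .
    have "(LINT x:?D|lborel. ?f (Z + (G0 x, H0 x))) = (LINT x:S \<union> (?D - S)|lborel. ?f (Z + (G0 x, H0 x)))"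
      using S by (simp add: Un_absorb1)
    also have "\<dots> = (LINT x:S|lborel. ?f (Z + (G0 x, H0 x))) + (LINT x:?D - S|lborel. ?f (Z + (G0 x, H0 x)))"
      using S by (intro set_integral_Un intf) auto
    finally have "\<Lambda> < (LINT x:?D|lborel. ?f (Z + (G0 x, H0 x)))"
      using 0(4) out mS by (simp add: m_def)
    also have "\<dots> = (LINT x:?D|lborel. norm (G x) ^ 5) - (LINT x:?D|lborel. \<Lambda> * norm (F x) ^ 5)"
      unfolding fx using F5
      by (intro set_integral_diff(2) set_integrable_mult_right int[OF _ G5] int[OF _ F5]) auto
    finally have "\<Lambda> < (LINT x:?D|lborel. norm (G x) ^ 5) - \<Lambda> * (LINT x:?D|lborel. norm (F x) ^ 5)" by simp
    moreover have "(LINT x:?D|lborel. norm (G x) ^ 5) = (LINT x|lebesgue_on ?D. norm (G x) powr 5)"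
      "(LINT x:?D|lborel. norm (F x) ^ 5) = (LINT x|lebesgue_on ?D. norm (F x) powr 5)"
      by (simp_all add: integral_lebesgue_on_borel)
    ultimately have "(LINT x|lebesgue_on ?D. norm (G x) powr 5) > \<Lambda> * (1 + (LINT x|lebesgue_on ?D. norm (F x) powr 5))"
      by (simp add: algebra_simps)
    moreover obtain L where "L-lipschitz_on UNIV u" using u by (auto simp: ae_grad_def)
    then have "L-lipschitz_on (cball 0 1) u" by (rule lipschitz_on_subset) simp
    moreover have "u x = fst Z \<bullet> x" if "x \<in> sphere 0 1" for x
    proof -
      have "x \<notin> S" using S that by auto
      then show ?thesis using 0(3) by (simp add: u_def)
    qed
    moreover have "div_eq ?D (\<lambda>x. A_field (49/81) (G x)) F"
      using div_eq_diff_rot_gradient[OF _ BV w open_ball] by (simp add: V_def[abs_def] F_def[abs_def])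
    moreover have "F \<in> L_infty ?D" by (rule L_infty_bounded[OF _ BF]) measurable
    ultimately show ?thesis
      using ae_grad_has_weak_gradient[OF u open_ball bounded_ball] ae_grad_W1_infty[OF u open_ball bounded_ball] by blast
  qed
  moreover have "linear (\<lambda>x. fst Z \<bullet> x)"
    by (rule bounded_linear.linear) (rule bounded_linear_inner_right)
  ultimately show ?thesis
    by (intro exI[of _ "49/81"] exI[of _ 5] exI[of _ "\<lambda>x. fst Z \<bullet> x"]) auto
qed

end
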